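(* Let $f\in H^2(\mathbb{B})$. Suppose that for all $\omega\in\mathbb{B}$ we have $$\frac1{2\pi}\int_0^{2\pi}\log\left|f_{I_\omega}\circ\tau_\omega(e^{\theta I_\omega})\right|d\theta=\log|f(\omega)|.$$ Then $f$ is outer.
   Context: $\mathbb{H}$ is the skew field of quaternions, $\mathbb{B}=\{q\in\mathbb{H}:|q|<1\}$, $\mathbb{S}=\{q\in\mathbb{H}:q^2=-1\}$; for $I\in\mathbb{S}$, $L_I=\mathbb{R}+\mathbb{R}I\cong\mathbb{C}$, $\mathbb{B}_I=\mathbb{B}\cap L_I$, and $f_I$ denotes the restriction of $f$ to the slice $L_I$ (to $\mathbb{B}_I$, or for boundary values to $\partial\mathbb{B}_I=\partial\mathbb{B}\cap L_I$). A function $f:\mathbb{B}\to\mathbb{H}$ is slice regular if, for every $I\in\mathbb{S}$, $f_I$ has continuous partial derivatives and $\frac12(\partial_x+I\partial_y)f_I(x+yI)=0$; equivalently $f(q)=\sum_{n\ge0}q^na_n$ on $\mathbb{B}$ with $a_n\in\mathbb{H}$. $H^2(\mathbb{B})$ is the space of slice regular functions $f(q)=\sum_{n\ge0}q^na_n$ with $(a_n)\in\ell^2(\mathbb{N},\mathbb{H})$. The boundary $\partial\mathbb{B}=\{e^{tI}=\cos t+\sin t\,I:I\in\mathbb{S},t\in\mathbb{R}\}$ carries the measure $d\Sigma(e^{tI})=d\sigma(I)\,dt$, with $dt$ Lebesgue measure on $[0,2\pi)$ and $d\sigma$ the standard area element of $\mathbb{S}$, normalized so that $\Sigma(\partial\mathbb{B})=1$.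 Every $f\in H^2(\mathbb{B})$ has boundary values $\Sigma$-a.e. on $\partial\mathbb{B}$ (and a.e. on each circle $\partial\mathbb{B}_I$), given by radial limits and still denoted $f$. $g\in H^2(\mathbb{B})$ is outer if for every $h\in H^2(\mathbb{B})$ with $|g(q)|=|h(q)|$ for $\Sigma$-a.e. $q\in\partial\mathbb{B}$ one has $|g(q)|\ge|h(q)|$ for all $q\in\mathbb{B}$. For $\omega\in\mathbb{B}$, $I_\omega$ denotes the imaginary unit identified by $\omega$: $I_\omega=\frac{\omega-\operatorname{Re}\omega}{|\omega-\operatorname{Re}\omega|}$ if $\omega$ is not real, and $I_\omega$ is any imaginary unit otherwise. $\tau_\omega$ is the slice regular Möbius transformation of the unit ball taking $0$ to $\omega$, whose restriction to the slice $L_{I_\omega}$ (the only values used here) is $\tau_\omega(z)=(1-z\overline\omega)^{-1}(\omega-z)$ for $z\in L_{I_\omega}$, $|z|\le1$. *)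

theory Defs
  imports "HOL-Analysis.Analysis"
begin

section \<open>The skew field of quaternions\<close>

text \<open>\<open>Quat a b c d\<close> is \<open>a + b i + c j + d k\<close>.\<close>

datatype quat = Quat (qre: real) (qim1: real) (qim2: real) (qim3: real)

lemma quat_eq_iff:
  "x = y \<longleftrightarrow> qre x = qre y \<and> qim1 x = qim1 y \<and> qim2 x = qim2 y \<and> qim3 x = qim3 y"
  by (cases x; cases y) simp

instantiation quat :: ab_group_add
begin

definition "0 = Quat 0 0 0 0"
definition "x + y = Quat (qre x + qre y) (qim1 x + qim1 y) (qim2 x + qim2 y) (qim3 x + qim3 y)"
definition "- x = Quat (- qre x) (- qim1 x) (- qim2 x) (- qim3 x)"
definition "x - y = Quat (qre x - qre y) (qim1 x - qim1 y) (qim2 x - qim2 y) (qim3 x - qim3 y)"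

instance
  by standard
    (simp_all add: quat_eq_iff zero_quat_def plus_quat_def uminus_quat_def minus_quat_def)

end

lemma quat_zero_sel [simp]: "qre 0 = 0" "qim1 0 = 0" "qim2 0 = 0" "qim3 0 = 0"
  by (simp_all add: zero_quat_def)

lemma quat_plus_sel [simp]:
  "qre (x + y) = qre x + qre y" "qim1 (x + y) = qim1 x + qim1 y"
  "qim2 (x + y) = qim2 x + qim2 y" "qim3 (x + y) = qim3 x + qim3 y"
  by (simp_all add: plus_quat_def)

lemma quat_uminus_sel [simp]:
  "qre (- x) = - qre x" "qim1 (- x) = - qim1 x" "qim2 (- x) = - qim2 x" "qim3 (- x) = - qim3 x"
  by (simp_all add: uminus_quat_def)

lemma quat_minus_sel [simp]:
  "qre (x - y) = qre x - qre y" "qim1 (x - y) = qim1 x - qim1 y"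
  "qim2 (x - y) = qim2 x - qim2 y" "qim3 (x - y) = qim3 x - qim3 y"
  by (simp_all add: minus_quat_def)

instantiation quat :: ring_1
begin

definition "1 = Quat 1 0 0 0"
definition "x * y = Quat
  (qre x * qre y - qim1 x * qim1 y - qim2 x * qim2 y - qim3 x * qim3 y)
  (qre x * qim1 y + qim1 x * qre y + qim2 x * qim3 y - qim3 x * qim2 y)
  (qre x * qim2 y - qim1 x * qim3 y + qim2 x * qre y + qim3 x * qim1 y)
  (qre x * qim3 y + qim1 x * qim2 y - qim2 x * qim1 y + qim3 x * qre y)"

instance
  by standard (simp_all add: quat_eq_iff one_quat_def times_quat_def algebra_simps)

end

lemma quat_one_sel [simp]: "qre 1 = 1" "qim1 1 = 0" "qim2 1 = 0" "qim3 1 = 0"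
  by (simp_all add: one_quat_def)

lemma quat_times_sel [simp]:
  "qre (x * y) = qre x * qre y - qim1 x * qim1 y - qim2 x * qim2 y - qim3 x * qim3 y"
  "qim1 (x * y) = qre x * qim1 y + qim1 x * qre y + qim2 x * qim3 y - qim3 x * qim2 y"
  "qim2 (x * y) = qre x * qim2 y - qim1 x * qim3 y + qim2 x * qre y + qim3 x * qim1 y"
  "qim3 (x * y) = qre x * qim3 y + qim1 x * qim2 y - qim2 x * qim1 y + qim3 x * qre y"
  by (simp_all add: times_quat_def)

definition qcnj :: "quat \<Rightarrow> quat"
  where "qcnj q = Quat (qre q) (- qim1 q) (- qim2 q) (- qim3 q)"

lemma qcnj_sel [simp]:
  "qre (qcnj q) = qre q" "qim1 (qcnj q) = - qim1 q"
  "qim2 (qcnj q) = - qim2 q" "qim3 (qcnj q) = - qim3 q"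
  by (simp_all add: qcnj_def)

instantiation quat :: real_algebra_1
begin

definition "r *\<^sub>R x = Quat (r * qre x) (r * qim1 x) (r * qim2 x) (r * qim3 x)"

instance
  by standard (simp_all add: quat_eq_iff scaleR_quat_def algebra_simps)

end

lemma quat_scaleR_sel [simp]:
  "qre (r *\<^sub>R x) = r * qre x" "qim1 (r *\<^sub>R x) = r * qim1 x"
  "qim2 (r *\<^sub>R x) = r * qim2 x" "qim3 (r *\<^sub>R x) = r * qim3 x"
  by (simp_all add: scaleR_quat_def)

lemma quat_of_real_sel [simp]:
  "qre (of_real r) = r" "qim1 (of_real r) = 0" "qim2 (of_real r) = 0" "qim3 (of_real r) = 0"
  by (simp_all add: of_real_def)

instantiation quat :: real_inner
begin

definition inner_quat :: "quat \<Rightarrow> quat \<Rightarrow> real"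
  where "inner_quat x y = qre x * qre y + qim1 x * qim1 y + qim2 x * qim2 y + qim3 x * qim3 y"

definition norm_quat :: "quat \<Rightarrow> real"
  where "norm_quat x = sqrt ((qre x)\<^sup>2 + (qim1 x)\<^sup>2 + (qim2 x)\<^sup>2 + (qim3 x)\<^sup>2)"

definition sgn_quat :: "quat \<Rightarrow> quat"
  where "sgn_quat x = x /\<^sub>R norm x"

definition dist_quat :: "quat \<Rightarrow> quat \<Rightarrow> real"
  where "dist_quat x y = norm (x - y)"

definition uniformity_quat_def [code del]:
  "(uniformity :: (quat \<times> quat) filter) = (INF e\<in>{0 <..}. principal {(x, y). dist x y < e})"

definition open_quat_def [code del]:
  "open (U :: quat set) \<longleftrightarrow> (\<forall>x\<in>U. eventually (\<lambda>(x', y). x' = x \<longrightarrow> y \<in> U) uniformity)"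

instance
proof
  fix r :: real and x y z :: quat
  show "0 \<le> inner x x"
    by (simp add: inner_quat_def)
  show "(inner x x = 0) = (x = 0)"
    by (auto simp: inner_quat_def quat_eq_iff add_nonneg_eq_0_iff)
  show "norm x = sqrt (inner x x)"
    by (simp add: inner_quat_def norm_quat_def power2_eq_square)
qed (simp_all add: inner_quat_def sgn_quat_def dist_quat_def uniformity_quat_def open_quat_def
      algebra_simps)

end

instantiation quat :: real_normed_div_algebra
begin

definition inverse_quat :: "quat \<Rightarrow> quat"
  where "inverse_quat x = qcnj x /\<^sub>R (norm x)\<^sup>2"

definition divide_quat :: "quat \<Rightarrow> quat \<Rightarrow> quat"
  where "divide_quat x y = x * inverse y"

instance
proof
  fix x y :: quat
  have nz: "(norm x)\<^sup>2 \<noteq> 0" if "x \<noteq> 0"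
    using that by simp
  have nsq: "(norm x)\<^sup>2 = (qre x)\<^sup>2 + (qim1 x)\<^sup>2 + (qim2 x)\<^sup>2 + (qim3 x)\<^sup>2" for x :: quat
    by (simp add: norm_quat_def)
  have l: "qcnj x * x = (norm x)\<^sup>2 *\<^sub>R 1" and r: "x * qcnj x = (norm x)\<^sup>2 *\<^sub>R 1"
    unfolding nsq by (simp_all add: quat_eq_iff power2_eq_square)
  show "inverse x * x = 1" if "x \<noteq> 0"
    using nz[OF that] by (simp add: inverse_quat_def l)
  show "x * inverse x = 1" if "x \<noteq> 0"
    using nz[OF that] by (simp add: inverse_quat_def r)
  have cm: "qcnj (x * y) = qcnj y * qcnj x"
    by (simp add: quat_eq_iff)
  have qq: "z * qcnj z = (norm z)\<^sup>2 *\<^sub>R 1" for z :: quat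
    unfolding nsq by (simp add: quat_eq_iff power2_eq_square)
  have "(norm (x * y))\<^sup>2 *\<^sub>R (1 :: quat) = x * (y * qcnj y) * qcnj x"
    by (simp only: qq[symmetric] cm mult.assoc)
  also have "\<dots> = ((norm x)\<^sup>2 * (norm y)\<^sup>2) *\<^sub>R 1"
    by (simp add: qq mult.commute)
  finally have "(norm (x * y))\<^sup>2 = (norm x * norm y)\<^sup>2"
    by (simp add: quat_eq_iff power_mult_distrib)
  then show "norm (x * y) = norm x * norm y"
    by (rule power2_eq_imp_eq) simp_all
  show "inverse (0 :: quat) = 0"
    by (simp add: inverse_quat_def quat_eq_iff)
qed (rule divide_quat_def)

end

instantiation quat :: euclidean_space
begin

definition "Basis = {Quat 1 0 0 0, Quat 0 1 0 0, Quat 0 0 1 0, Quat 0 0 0 1}"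

instance
proof
  fix u v x :: quat
  show "(Basis :: quat set) \<noteq> {}" and "finite (Basis :: quat set)"
    by (simp_all add: Basis_quat_def)
  show "inner u v = (if u = v then 1 else 0)" if "u \<in> Basis" "v \<in> Basis"
    using that unfolding Basis_quat_def inner_quat_def by (elim insertE emptyE) simp_all
  show "(\<forall>u\<in>Basis. inner x u = 0) = (x = 0)"
    by (cases x) (simp add: Basis_quat_def inner_quat_def zero_quat_def)
qed

end

instance quat :: banach ..

section \<open>Slice regular functions and the Hardy space\<close>

definition imag_units :: "quat set"
  where "imag_units = {q. q\<^sup>2 = - 1}"

text \<open>Functions on the ball are total functions on \<^typ>\<open>quat\<close> whose values outside
  \<open>ball 0 1\<close> are never used.\<close>

definition slice_regular :: "(quat \<Rightarrow> quat) \<Rightarrow> bool"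
  where "slice_regular f \<longleftrightarrow> (\<forall>I\<in>imag_units. \<exists>fx fy :: real \<times> real \<Rightarrow> quat.
    continuous_on {(x, y). x\<^sup>2 + y\<^sup>2 < 1} fx \<and> continuous_on {(x, y). x\<^sup>2 + y\<^sup>2 < 1} fy \<and>
    (\<forall>x y. x\<^sup>2 + y\<^sup>2 < 1 \<longrightarrow>
      ((\<lambda>s. f (of_real s + y *\<^sub>R I)) has_vector_derivative fx (x, y)) (at x) \<and>
      ((\<lambda>s. f (of_real x + s *\<^sub>R I)) has_vector_derivative fy (x, y)) (at y) \<and>
      (1 / 2) *\<^sub>R (fx (x, y) + I * fy (x, y)) = 0))"

definition hardy2 :: "(quat \<Rightarrow> quat) set"
  where "hardy2 = {f. slice_regular f \<and>
    (\<exists>a :: nat \<Rightarrow> quat. summable (\<lambda>n. (norm (a n))\<^sup>2) \<and>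
      (\<forall>q\<in>ball 0 1. (\<lambda>n. q ^ n * a n) sums f q))}"

text \<open>The boundary value is unspecified at points where the radial limit does not exist.\<close>

definition radial_limit :: "(quat \<Rightarrow> quat) \<Rightarrow> quat \<Rightarrow> quat"
  where "radial_limit f q = Lim (at_left 1) (\<lambda>r. f (r *\<^sub>R q))"

section \<open>The measure on the boundary of the ball\<close>

text \<open>\<open>qcis I t\<close> is \<open>e\<^sup>t\<^sup>I\<close>.\<close>

definition qcis :: "quat \<Rightarrow> real \<Rightarrow> quat"
  where "qcis I t = of_real (cos t) + sin t *\<^sub>R I"

definition sphere_point :: "real \<times> real \<Rightarrow> quat"
  where "sphere_point = (\<lambda>(\<phi>, \<psi>). Quat 0 (sin \<phi> * cos \<psi>) (sin \<phi> * sin \<psi>) (cos \<phi>))"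

text \<open>The area element \<open>sin \<phi> d\<phi> d\<psi>\<close> of the 2-sphere of imaginary units in spherical
  coordinates.\<close>

definition sphere_area :: "quat measure"
  where "sphere_area = distr
    (density (lborel :: (real \<times> real) measure)
      (\<lambda>(\<phi>, \<psi>). ennreal (sin \<phi>) * indicator ({0..pi} \<times> {0..<2 * pi}) (\<phi>, \<psi>)))
    borel sphere_point"

text \<open>The total mass of \<open>d\<sigma>(I) dt\<close> is \<open>4 \<pi> \<cdot> 2 \<pi>\<close>. The map \<open>(I, t) \<mapsto> e\<^sup>t\<^sup>I\<close> is two-to-one off
  the real axis; the measure is the image of the product measure.\<close>

definition boundary_measure :: "quat measure"
  where "boundary_measure = scale_measure (ennreal (1 / (8 * pi\<^sup>2)))
    (distr (sphere_area \<Otimes>\<^sub>M restrict_space lborel {0..<2 * pi}) borel (\<lambda>(I, t). qcis I t))"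

lemma continuous_on_Quat [continuous_intros]:
  assumes "continuous_on A a" "continuous_on A b" "continuous_on A c" "continuous_on A d"
  shows "continuous_on A (\<lambda>x. Quat (a x) (b x) (c x) (d x))"
proof -
  have "(\<lambda>x. Quat (a x) (b x) (c x) (d x)) =
      (\<lambda>x. a x *\<^sub>R Quat 1 0 0 0 + b x *\<^sub>R Quat 0 1 0 0 + c x *\<^sub>R Quat 0 0 1 0 + d x *\<^sub>R Quat 0 0 0 1)"
    by (simp add: fun_eq_iff quat_eq_iff)
  then show ?thesis
    by (simp only:) (intro continuous_intros assms)
qed

lemma measurable_sphere_point [measurable]: "sphere_point \<in> borel_measurable borel"
  unfolding sphere_point_def case_prod_unfold
  by (intro borel_measurable_continuous_onI continuous_intros)

lemma measurable_qcis [measurable]: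
  "(\<lambda>(I, t). qcis I t) \<in> borel_measurable (borel \<Otimes>\<^sub>M borel)"
  unfolding qcis_def case_prod_unfold borel_prod
  by (intro borel_measurable_continuous_onI continuous_intros)

lemma sphere_point_imag: "sphere_point p \<in> imag_units"
proof -
  have "(sin a * cos b)\<^sup>2 + (sin a * sin b)\<^sup>2 + (cos a)\<^sup>2 = 1" for a b :: real
  proof -
    have "(sin a * cos b)\<^sup>2 + (sin a * sin b)\<^sup>2 + (cos a)\<^sup>2
        = (sin a)\<^sup>2 * ((cos b)\<^sup>2 + (sin b)\<^sup>2) + (cos a)\<^sup>2"
      by (simp only: power_mult_distrib distrib_left)
    then show ?thesis by simp
  qed
  from this[of "fst p" "snd p"] show ?thesis
    by (simp add: sphere_point_def imag_units_def case_prod_unfold power2_eq_square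
        quat_eq_iff)
qed

lemma imag_units_iff: "q \<in> imag_units \<longleftrightarrow> qre q = 0 \<and> norm q = 1"
proof
  assume q: "q \<in> imag_units"
  then have e: "qre q * qre q - qim1 q * qim1 q - qim2 q * qim2 q - qim3 q * qim3 q = - 1"
    "qre q * qim1 q = 0" "qre q * qim2 q = 0" "qre q * qim3 q = 0"
    by (auto simp: imag_units_def power2_eq_square quat_eq_iff)
  have "norm q ^ 2 = 1"
    using q by (simp add: imag_units_def norm_power[symmetric])
  then have n: "norm q = 1" by (simp add: power2_eq_1_iff norm_ge_zero) (use norm_ge_zero[of q] in linarith)
  have "qre q = 0"
  proof (rule ccontr)
    assume "qre q \<noteq> 0"
    with e have "qre q * qre q = - 1" by simp
    then show False using zero_le_square[of "qre q"] by linarith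
  qed
  with n show "qre q = 0 \<and> norm q = 1" by simp
next
  assume "qre q = 0 \<and> norm q = 1"
  then have "qre q = 0" "qim1 q * qim1 q + qim2 q * qim2 q + qim3 q * qim3 q = 1"
    by (auto simp: norm_quat_def power2_eq_square)
  then show "q \<in> imag_units"
    by (simp add: imag_units_def power2_eq_square quat_eq_iff)
qed

lemma norm_qcis:
  assumes "I \<in> imag_units"
  shows "norm (qcis I t) = 1"
proof -
  have I: "qre I = 0" "(qim1 I)\<^sup>2 + (qim2 I)\<^sup>2 + (qim3 I)\<^sup>2 = 1"
    using assms by (auto simp: imag_units_iff norm_quat_def)
  have "(norm (qcis I t))\<^sup>2 = (cos t)\<^sup>2 + (sin t)\<^sup>2 * ((qim1 I)\<^sup>2 + (qim2 I)\<^sup>2 + (qim3 I)\<^sup>2)"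
    by (simp add: norm_quat_def qcis_def I(1) power_mult_distrib distrib_left)
  then have "(norm (qcis I t))\<^sup>2 = 1"
    by (simp add: I(2))
  then show ?thesis
    by (metis norm_ge_zero one_power2 power2_eq_imp_eq zero_le_one)
qed

lemma sets_sphere_area [simp, measurable_cong]: "sets sphere_area = sets borel"
  by (simp add: sphere_area_def)

lemma space_sphere_area [simp]: "space sphere_area = UNIV"
  by (simp add: sphere_area_def)

lemma measurable_area_density [measurable]:
  "(\<lambda>(\<phi>, \<psi>). ennreal (sin \<phi>) * indicator ({0..pi} \<times> {0..<2 * pi}) (\<phi>, \<psi>))
    \<in> borel_measurable (borel :: (real \<times> real) measure)"
  unfolding borel_prod[symmetric] by measurable

lemma emeasure_sphere_area: "emeasure sphere_area UNIV = ennreal (4 * pi)"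
proof -
  have 1: "(\<integral>\<^sup>+ \<phi>. ennreal (sin \<phi>) * indicator {0..pi} \<phi> \<partial>lborel) = ennreal 2"
  proof -
    have "(\<integral>\<^sup>+ \<phi>. ennreal (sin \<phi>) * indicator {0..pi} \<phi> \<partial>lborel) = ennreal (- cos pi - (- cos 0))"
      by (rule nn_integral_FTC_Icc) (auto intro!: derivative_eq_intros sin_ge_zero)
    then show ?thesis by simp
  qed
  have "emeasure sphere_area UNIV =
      (\<integral>\<^sup>+ p. (case p of (\<phi>, \<psi>) \<Rightarrow> ennreal (sin \<phi>) * indicator ({0..pi} \<times> {0..<2 * pi}) (\<phi>, \<psi>)) \<partial>lborel)"
    by (simp add: sphere_area_def emeasure_distr emeasure_density)
  also have "\<dots> = (\<integral>\<^sup>+ \<phi>. \<integral>\<^sup>+ \<psi>. ennreal (sin \<phi>) * indicator ({0..pi} \<times> {0..<2 * pi}) (\<phi>, \<psi>) \<partial>lborel \<partial>lborel)"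
    unfolding lborel_prod[symmetric]
    by (subst lborel.nn_integral_fst[symmetric]) (simp_all add: borel_prod)
  also have "\<dots> = (\<integral>\<^sup>+ \<phi>. ennreal (sin \<phi>) * indicator {0..pi} \<phi> * ennreal (2 * pi) \<partial>lborel)"
    by (intro nn_integral_cong) (simp add: indicator_times mult.assoc[symmetric] nn_integral_cmult)
  also have "\<dots> = ennreal 2 * ennreal (2 * pi)"
    by (simp add: nn_integral_multc 1 del: ennreal_numeral)
  also have "\<dots> = ennreal (4 * pi)"
    by (subst ennreal_mult[symmetric]) simp_all
  finally show ?thesis .
qed

lemma measurable_imag_units [measurable]: "imag_units \<in> sets borel"
proof -
  have "closed imag_units"
    unfolding imag_units_def by (intro closed_Collect_eq continuous_intros)
  then show ?thesis by (rule borel_closed)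
qed

lemma AE_sphere_area: "AE I in sphere_area. I \<in> imag_units"
  unfolding sphere_area_def by (subst AE_distr_iff) (simp_all add: sphere_point_imag)

interpretation sphere_area: finite_measure sphere_area
  by standard (simp add: emeasure_sphere_area)

lemma measurable_qcis_product [measurable]:
  "(\<lambda>(I, t). qcis I t) \<in> borel_measurable (sphere_area \<Otimes>\<^sub>M restrict_space lborel {0..<2 * pi})"
proof -
  have "(\<lambda>p. (fst p, snd p)) \<in> sphere_area \<Otimes>\<^sub>M restrict_space lborel {0..<2 * pi} \<rightarrow>\<^sub>M borel \<Otimes>\<^sub>M (borel :: real measure)"
    by (intro measurable_Pair measurable_compose[OF measurable_snd])
      (auto intro: measurable_restrict_space1)
  from measurable_compose[OF this measurable_qcis] show ?thesis
    by (simp add: case_prod_unfold)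
qed

lemma finite_angle: "finite_measure (restrict_space lborel {0..<2 * pi :: real})"
  by standard (simp add: emeasure_restrict_space space_restrict_space)

lemma emeasure_boundary_measure:
  "emeasure boundary_measure UNIV = 1" "emeasure boundary_measure (sphere 0 1) = 1"
proof -
  interpret angle: finite_measure "restrict_space lborel {0..<2 * pi :: real}"
    by (rule finite_angle)
  let ?T = "{0..<2 * pi :: real}"
  let ?P = "sphere_area \<Otimes>\<^sub>M restrict_space lborel ?T"
  have T: "?T \<in> sets (restrict_space lborel ?T)"
    using sets.top[of "restrict_space lborel ?T"] by (simp add: space_restrict_space)
  have mass: "emeasure ?P (A \<times> ?T) = ennreal (8 * pi\<^sup>2)"
    if "emeasure sphere_area A = ennreal (4 * pi)" "A \<in> sets borel" for A
  proof -
    have "emeasure ?P (A \<times> ?T) = ennreal (4 * pi) * ennreal (2 * pi)"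
      using that by (subst angle.emeasure_pair_measure_Times)
        (simp_all add: emeasure_restrict_space T)
    then show ?thesis
      by (simp add: ennreal_mult[symmetric] power2_eq_square)
  qed
  have one: "ennreal (1 / (8 * pi\<^sup>2)) * ennreal (8 * pi\<^sup>2) = 1"
    by (subst ennreal_mult[symmetric]) simp_all
  show U: "emeasure boundary_measure UNIV = 1"
    using mass[of UNIV] one
    by (simp add: boundary_measure_def emeasure_distr space_pair_measure space_restrict_space
        emeasure_sphere_area)
  have "emeasure sphere_area imag_units = emeasure sphere_area UNIV"
    using AE_sphere_area by (intro emeasure_eq_AE) auto
  then have I: "emeasure ?P (imag_units \<times> ?T) = ennreal (8 * pi\<^sup>2)"
    by (intro mass) (simp_all add: emeasure_sphere_area)
  have "emeasure ?P (imag_units \<times> ?T) \<le> emeasure ?P ((\<lambda>(I, t). qcis I t) -` sphere 0 1 \<inter> space ?P)"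
    by (intro emeasure_mono measurable_sets[OF measurable_qcis_product])
      (auto simp: norm_qcis space_pair_measure space_restrict_space)
  then have "ennreal (1 / (8 * pi\<^sup>2)) * ennreal (8 * pi\<^sup>2) \<le> emeasure boundary_measure (sphere 0 1)"
    unfolding I boundary_measure_def
    by (simp add: emeasure_distr mult_left_mono)
  moreover have "emeasure boundary_measure (sphere 0 1) \<le> emeasure boundary_measure UNIV"
    by (intro emeasure_mono) (simp_all add: boundary_measure_def)
  ultimately show "emeasure boundary_measure (sphere 0 1) = 1"
    unfolding one U by (rule antisym[rotated])
qed

section \<open>Outer functions\<close>

definition outer :: "(quat \<Rightarrow> quat) \<Rightarrow> bool"
  where "outer g \<longleftrightarrow> g \<in> hardy2 \<and>
    (\<forall>h\<in>hardy2.
      (AE q in boundary_measure. norm (radial_limit g q) = norm (radial_limit h q)) \<longrightarrow>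
      (\<forall>q\<in>ball 0 1. norm (g q) \<ge> norm (h q)))"

section \<open>Logarithmic means\<close>

text \<open>The real logarithm of the library has \<open>ln 0 = 0\<close>; here \<open>log 0 = -\<infinity>\<close>.\<close>

definition elog :: "real \<Rightarrow> ereal"
  where "elog x = (if x \<le> 0 then - \<infinity> else ereal (ln x))"

text \<open>The integral of an extended real function as the difference of the integrals of its
  positive and negative parts. If both are infinite the value is \<open>\<infinity>\<close>; this does not
  occur for \<open>log |f|\<close> with \<open>f\<close> in the Hardy space, where the positive part is integrable.\<close>

definition ext_integral :: "'a measure \<Rightarrow> ('a \<Rightarrow> ereal) \<Rightarrow> ereal"
  where "ext_integral M u =
    enn2ereal (\<integral>\<^sup>+ x. e2ennreal (u x) \<partial>M) - enn2ereal (\<integral>\<^sup>+ x. e2ennreal (- u x) \<partial>M)"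

text \<open>For real \<open>\<omega>\<close> every imaginary unit is admissible.\<close>

definition identified_unit :: "quat \<Rightarrow> quat \<Rightarrow> bool"
  where "identified_unit \<omega> I \<longleftrightarrow> I \<in> imag_units \<and>
    (\<omega> \<notin> \<real> \<longrightarrow> I = (\<omega> - of_real (qre \<omega>)) /\<^sub>R norm (\<omega> - of_real (qre \<omega>)))"

text \<open>The slice regular Moebius transformation, given by this formula only on the slice
  containing \<open>\<omega>\<close>.\<close>

definition slice_moebius :: "quat \<Rightarrow> quat \<Rightarrow> quat"
  where "slice_moebius \<omega> z = inverse (1 - z * qcnj \<omega>) * (\<omega> - z)"

end

theory Submission
  imports Defs "HOL-Complex_Analysis.Complex_Analysis"
begin

text \<open>The point is that for every \<open>h\<close> in the Hardy space, every imaginary unit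
  \<open>I\<close> and every \<open>\<omega>\<close> in the slice of \<open>I\<close>,
  \<open>log \<bar>h(\<omega>)\<bar>\<close> is at most the mean of \<open>log \<bar>h \<circ>
  \<tau>\<^sub>\<omega>\<bar>\<close> over the unit circle of the slice (lemma
  \<open>hardy2_elog_le\<close>). If \<open>\<bar>h\<bar> = \<bar>f\<bar>\<close> almost
  everywhere on the boundary, then for almost every \<open>I\<close> the moduli agree almost
  everywhere on the circle of the slice (lemma \<open>AE_boundary_slices\<close>). For such
  \<open>I\<close> the mean for \<open>h\<close> is the mean for \<open>f\<close>, which by
  hypothesis is \<open>log \<bar>f(\<omega>)\<bar>\<close>, so \<open>\<bar>h\<bar> \<le>
  \<bar>f\<bar>\<close> at every point \<open>x + y I\<close> with \<open>y > 0\<close>, for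
  which \<open>I\<close> is the identified unit. Such \<open>I\<close> are dense in the sphere
  (lemma \<open>sphere_area_continuous_nonneg\<close>), and \<open>f\<close> and
  \<open>h\<close> are continuous on the ball, so the inequality holds everywhere.

  The inequality for \<open>h\<close> reduces to a scalar one: a right multiple of
  \<open>h\<close> by a unit quaternion is projected to the slice, which gives a complex power
  series \<open>phi\<close> with square summable coefficients, of modulus
  \<open>\<bar>h\<bar>\<close> at \<open>\<omega>\<close> and at most
  \<open>\<bar>h\<bar>\<close> elsewhere on the slice. Since boundary values are pointwise
  radial limits, their existence almost everywhere is needed: this is Fatou's theorem
  (\<open>AE_radial_limit\<close>). Its proof takes an \<open>L\<^sup>1\<close> limit of
  dilations \<open>z \<mapsto> phi (r z)\<close>, represents \<open>phi\<close> by the Poisson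
  formula integrated by parts, and uses Lebesgue differentiation.

  The scalar inequality is Jensen's inequality (\<open>jensen_inequality_majorant\<close>) for
  the dilations of \<open>phi\<close>, composed with a Moebius transformation and with the
  logarithm truncated from below. \<open>L\<^sup>1\<close> convergence of the dilations carries
  it to the boundary (\<open>log_phi_le_log_max\<close>), and the truncation is removed by
  Fatou's lemma (\<open>elog_phi_le\<close>).\<close>

section \<open>Integrals over the unit circle\<close>

text \<open>The integral of a nonnegative function over the unit circle in arc length, with total mass
  \<open>2 \<pi>\<close>.\<close>

definition circle_integral :: "(complex \<Rightarrow> ennreal) \<Rightarrow> ennreal"
  where "circle_integral u = (\<integral>\<^sup>+ t. u (cis t) * indicator {0..2 * pi} t \<partial>lborel)"

lemma measurable_cis [measurable]: "cis \<in> borel_measurable borel"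
  by (intro borel_measurable_continuous_onI continuous_intros)

lemma cis_plus_2pi_int: "cis (2 * pi * real_of_int k + t) = cis t"
  using cis_multiple_2pi[of "of_int k"] by (simp add: cis_mult[symmetric])

text \<open>Any arc of length \<open>2 \<pi>\<close> may be used to parametrise the circle.\<close>

lemma circle_integral_shift:
  assumes [measurable]: "u \<in> borel_measurable borel"
  shows "(\<integral>\<^sup>+ t. u (cis t) * indicator {a..a + 2 * pi} t \<partial>lborel) = circle_integral u"
proof -
  define F where "F x y = (\<integral>\<^sup>+ t. u (cis t) * indicator {x..<y} t \<partial>lborel)" for x y
  have split: "F x z = F x y + F y z" if "x \<le> y" "y \<le> z" for x y z
    unfolding F_def using that
    by (subst nn_integral_add[symmetric]) (auto intro!: nn_integral_cong split: split_indicator)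
  have shift: "F (2 * pi * of_int k + x) (2 * pi * of_int k + y) = F x y" for k x y
  proof -
    have "F (2 * pi * of_int k + x) (2 * pi * of_int k + y) =
        (\<integral>\<^sup>+ t. u (cis (2 * pi * of_int k + 1 * t)) *
          indicator {2 * pi * of_int k + x..<2 * pi * of_int k + y} (2 * pi * of_int k + 1 * t) \<partial>lborel)"
      unfolding F_def by (subst nn_integral_real_affine[where c = 1 and t = "2 * pi * of_int k"]) simp_all
    also have "\<dots> = F x y"
      unfolding F_def by (intro nn_integral_cong) (simp add: cis_plus_2pi_int split: split_indicator)
    finally show ?thesis .
  qed
  have closed: "(\<integral>\<^sup>+ t. u (cis t) * indicator {x..y} t \<partial>lborel) = F x y" for x y
    unfolding F_def
  proof (rule nn_integral_cong_AE)
    show "AE t in lborel. u (cis t) * indicator {x..y} t = u (cis t) * indicator {x..<y} t"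
      using AE_lborel_singleton[of y] by eventually_elim (auto split: split_indicator)
  qed
  \<comment> \<open>A multiple of \<open>2 \<pi>\<close> inside the arc, where the arc is cut into two pieces that are translated separately.\<close>
  define k where "k = \<lceil>a / (2 * pi)\<rceil>"
  define b where "b = 2 * pi * of_int k"
  have "a / (2 * pi) \<le> of_int k" "of_int k < a / (2 * pi) + 1"
    unfolding k_def by linarith+
  then have ab: "a \<le> b" "b \<le> a + 2 * pi"
    unfolding b_def by (simp_all add: field_simps)
  have "F a (a + 2 * pi) = F a b + F b (a + 2 * pi)"
    using ab by (intro split)
  also have "F a b = F (a - b + 2 * pi) (2 * pi)"
    using shift[of "k - 1" "a - b + 2 * pi" "2 * pi"] by (simp add: b_def algebra_simps)
  also have "F b (a + 2 * pi) = F 0 (a - b + 2 * pi)"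
    using shift[of k 0 "a - b + 2 * pi"] by (simp add: b_def algebra_simps)
  also have "F (a - b + 2 * pi) (2 * pi) + F 0 (a - b + 2 * pi) = F 0 (2 * pi)"
    using ab split[of 0 "a - b + 2 * pi" "2 * pi"] by (simp add: add.commute)
  finally show ?thesis
    by (simp add: closed circle_integral_def)
qed

text \<open>Exceptional sets on the circle are handled as null sets of angles on the whole line, which
  makes them insensitive to the choice of an arc.\<close>

lemma AE_line_if_circle:
  assumes "AE t in lborel. t \<in> {0..2 * pi} \<longrightarrow> P (cis t)"
  shows "AE t in lborel. P (cis t)"
proof -
  have "AE t in lborel. \<forall>k::int. t - 2 * pi * of_int k \<in> {0..2 * pi} \<longrightarrow> P (cis (t - 2 * pi * of_int k))"
  proof (subst AE_all_countable, rule allI)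
    fix k :: int
    have "AE t in distr lborel borel ((+) (- (2 * pi * of_int k))). t \<in> {0..2 * pi} \<longrightarrow> P (cis t)"
      unfolding lborel_distr_plus by (rule assms)
    then have "AE t in lborel. (- (2 * pi * of_int k) + t) \<in> {0..2 * pi} \<longrightarrow> P (cis (- (2 * pi * of_int k) + t))"
      by (rule AE_distrD[rotated]) simp
    then show "AE t in lborel. t - 2 * pi * of_int k \<in> {0..2 * pi} \<longrightarrow> P (cis (t - 2 * pi * of_int k))"
      by (simp add: algebra_simps)
  qed
  then show ?thesis
  proof eventually_elim
    case (elim t)
    define k where "k = \<lfloor>t / (2 * pi)\<rfloor>"
    have "of_int k \<le> t / (2 * pi)" "t / (2 * pi) \<le> of_int k + 1"
      unfolding k_def by linarith+
    then have "t - 2 * pi * of_int k \<in> {0..2 * pi}"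
      by (simp add: field_simps)
    moreover have "cis (t - 2 * pi * of_int k) = cis t"
      using cis_plus_2pi_int[of "- k" t] by simp
    ultimately show ?case using elim by metis
  qed
qed

section \<open>Power series with square summable coefficients\<close>

lemma has_integral_cis_int:
  assumes "k \<noteq> (0::int)"
  shows "((\<lambda>t. cis (of_int k * t)) has_integral 0) {0..2 * pi}"
proof -
  have d: "((\<lambda>t. cis (of_int k * t) / (\<i> * of_int k)) has_vector_derivative cis (of_int k * t))
     (at t within S)" for t S
  proof -
    have "((\<lambda>z. exp (\<i> * of_int k * z) / (\<i> * of_int k)) has_field_derivative exp (\<i> * of_int k * of_real t))
        (at (of_real t))"
      using assms by (auto intro!: derivative_eq_intros)
    from has_vector_derivative_real_field[OF this]
    have "((\<lambda>t. exp (\<i> * of_int k * of_real t) / (\<i> * of_int k)) has_vector_derivative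
        exp (\<i> * of_int k * of_real t)) (at t within S)" .
    then show ?thesis by (simp add: cis_conv_exp mult.assoc)
  qed
  have "((\<lambda>t. cis (of_int k * t)) has_integral
     (cis (of_int k * (2*pi)) / (\<i> * of_int k) - cis (of_int k * 0) / (\<i> * of_int k))) {0..2 * pi}"
    by (rule fundamental_theorem_of_calculus) (use d in auto)
  then show ?thesis
    using cis_plus_2pi_int[of k 0] by (simp add: mult.commute mult.left_commute)
qed

lemma has_integral_trig_poly_sq:
  "((\<lambda>t. (cmod (\<Sum>n<N. c n * cis t ^ n))\<^sup>2) has_integral 2 * pi * (\<Sum>n<N. (cmod (c n))\<^sup>2)) {0..2 * pi}"
proof (induction N)
  case 0
  then show ?case by simp
next
  case (Suc N)
  let ?S = "\<lambda>t. \<Sum>n<N. c n * cis t ^ n"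
  have "((\<lambda>t. \<Sum>n<N. (c n * cnj (c N)) * cis (of_int (int n - int N) * t)) has_integral (\<Sum>n<N. (c n * cnj (c N)) * 0)) {0..2 * pi}"
    by (intro has_integral_sum has_integral_mult_right has_integral_cis_int) auto
  also have "(\<lambda>t. \<Sum>n<N. (c n * cnj (c N)) * cis (of_int (int n - int N) * t)) =
       (\<lambda>t. ?S t * cnj (c N * cis t ^ N))"
  proof
    fix t
    have shift: "cis (of_int (int n - int N) * t) = cis t ^ n * cnj (cis t ^ N)" for n
      by (simp add: cis_cnj Complex.DeMoivre cis_mult algebra_simps)
    show "(\<Sum>n<N. (c n * cnj (c N)) * cis (of_int (int n - int N) * t)) = ?S t * cnj (c N * cis t ^ N)"
      unfolding sum_distrib_right shift by (intro sum.cong refl) (simp add: mult_ac)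
  qed
  finally have "((\<lambda>t. ?S t * cnj (c N * cis t ^ N)) has_integral 0) {0..2*pi}" by simp
  then have "((\<lambda>t. Re (?S t * cnj (c N * cis t ^ N))) has_integral 0) {0..2*pi}"
    by (drule_tac has_integral_linear[OF _ bounded_linear_Re]) (simp only: o_def zero_complex.sel)
  then have "((\<lambda>t. (cmod (?S t))\<^sup>2 + (cmod (c N))\<^sup>2 + 2 * Re (?S t * cnj (c N * cis t ^ N))) has_integral
      2 * pi * (\<Sum>n<N. (cmod (c n))\<^sup>2) + 2 * pi * (cmod (c N))\<^sup>2 + 2 * 0) {0..2 * pi}"
    using has_integral_const_real[of "(cmod (c N))\<^sup>2" 0 "2*pi"]
    by (intro has_integral_add has_integral_mult_right Suc) simp_all
  moreover have "(cmod (\<Sum>n<Suc N. c n * cis t ^ n))\<^sup>2 =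
      (cmod (?S t))\<^sup>2 + (cmod (c N))\<^sup>2 + 2 * Re (?S t * cnj (c N * cis t ^ N))" for t
  proof -
    have "(cmod (x + y))\<^sup>2 = (cmod x)\<^sup>2 + (cmod y)\<^sup>2 + 2 * Re (x * cnj y)" for x y
      unfolding cmod_power2 by (simp add: power2_eq_square algebra_simps)
    from this[of "?S t" "c N * cis t ^ N"] show ?thesis
      by (simp only: norm_mult norm_power norm_cis power_one mult_1_right sum.lessThan_Suc)
  qed
  moreover have "2 * pi * (\<Sum>n<N. (cmod (c n))\<^sup>2) + 2 * pi * (cmod (c N))\<^sup>2 + 2 * 0
      = 2 * pi * (\<Sum>n<Suc N. (cmod (c n))\<^sup>2)"
    by (simp add: algebra_simps)
  ultimately show ?case
    by (simp only:)
qed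

lemma parseval_le:
  assumes F: "\<And>z. cmod z = 1 \<Longrightarrow> (\<lambda>n. c n * z ^ n) sums F z"
    and c: "summable (\<lambda>n. (cmod (c n))\<^sup>2)"
  shows "circle_integral (\<lambda>z. ennreal ((cmod (F z))\<^sup>2)) \<le> ennreal (2 * pi * (\<Sum>n. (cmod (c n))\<^sup>2))"
proof -
  let ?S = "\<lambda>N t. (cmod (\<Sum>n<N. c n * cis t ^ n))\<^sup>2"
  have part: "(\<integral>\<^sup>+ t. ennreal (?S N t) * indicator {0..2 * pi} t \<partial>lborel)
      \<le> ennreal (2 * pi * (\<Sum>n. (cmod (c n))\<^sup>2))" for N
  proof -
    have "(\<integral>\<^sup>+ t. ennreal (?S N t) * indicator {0..2 * pi} t \<partial>lborel)
        = ennreal (2 * pi * (\<Sum>n<N. (cmod (c n))\<^sup>2))"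
      by (rule nn_integral_has_integral_lebesgue'[OF _ has_integral_trig_poly_sq]) simp
    also have "\<dots> \<le> ennreal (2 * pi * (\<Sum>n. (cmod (c n))\<^sup>2))"
      by (intro ennreal_leI mult_left_mono sum_le_suminf c) simp_all
    finally show ?thesis .
  qed
  have lim: "(\<lambda>N. ennreal (?S N t) * indicator {0..2 * pi} t) \<longlonglongrightarrow> ennreal ((cmod (F (cis t)))\<^sup>2) * indicator {0..2 * pi} t" for t
  proof -
    have "(\<lambda>N. \<Sum>n<N. c n * cis t ^ n) \<longlonglongrightarrow> F (cis t)"
      using F[of "cis t"] by (simp add: sums_def)
    then have "(\<lambda>N. ennreal (?S N t)) \<longlonglongrightarrow> ennreal ((cmod (F (cis t)))\<^sup>2)"
      by (intro tendsto_intros tendsto_ennrealI)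
    then show ?thesis by (cases "t \<in> {0..2*pi}") simp_all
  qed
  have "circle_integral (\<lambda>z. ennreal ((cmod (F z))\<^sup>2)) =
      (\<integral>\<^sup>+ t. liminf (\<lambda>N. ennreal (?S N t) * indicator {0..2 * pi} t) \<partial>lborel)"
    unfolding circle_integral_def using lim_imp_Liminf[OF _ lim] by simp
  also have "\<dots> \<le> liminf (\<lambda>N. \<integral>\<^sup>+ t. ennreal (?S N t) * indicator {0..2 * pi} t \<partial>lborel)"
    by (rule nn_integral_liminf) simp
  also have "\<dots> \<le> liminf (\<lambda>N::nat. ennreal (2 * pi * (\<Sum>n. (cmod (c n))\<^sup>2)))"
    by (intro Liminf_mono always_eventually allI part)
  finally show ?thesis by (simp add: Liminf_const)
qed

lemma square_summable_imp_bounded: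
  fixes a :: "nat \<Rightarrow> 'a :: real_normed_vector"
  assumes "summable (\<lambda>n. (norm (a n))\<^sup>2)"
  shows "\<exists>B. \<forall>n. norm (a n) \<le> B"
proof -
  have "Bseq (\<lambda>n. (norm (a n))\<^sup>2)"
    using summable_LIMSEQ_zero[OF assms] by (intro convergent_imp_Bseq convergentI)
  then obtain K where K: "K > 0" "\<And>n. (norm (a n))\<^sup>2 \<le> K"
    by (auto simp: Bseq_def)
  then have "norm (a n) \<le> sqrt K" for n
    by (simp add: real_le_rsqrt)
  then show ?thesis by blast
qed

text \<open>The scalar Hardy space: \<open>phi z = \<Sum>a\<^sub>n z\<^sup>n\<close> on the unit disc with
  \<open>\<Sum>\<bar>a\<^sub>n\<bar>\<^sup>2 < \<infinity>\<close>.\<close>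

locale l2_power_series =
  fixes a :: "nat \<Rightarrow> complex"
  assumes square_summable: "summable (\<lambda>n. (cmod (a n))\<^sup>2)"
begin

definition phi :: "complex \<Rightarrow> complex"
  where "phi z = (\<Sum>n. a n * z ^ n)"

lemma abs_summable:
  assumes "cmod z < 1"
  shows "summable (\<lambda>n. cmod (a n * z ^ n))"
proof -
  obtain B where B: "\<And>n. cmod (a n) \<le> B"
    using square_summable_imp_bounded[OF square_summable] by blast
  have "summable (\<lambda>n. B * cmod z ^ n)"
    using assms by (intro summable_mult summable_geometric) simp
  then show ?thesis
    by (rule summable_comparison_test[rotated])
      (simp add: norm_mult norm_power B mult_right_mono)
qed

lemma sums_phi: "cmod z < 1 \<Longrightarrow> (\<lambda>n. a n * z ^ n) sums phi z"
  unfolding phi_def by (rule summable_sums[OF summable_norm_cancel[OF abs_summable]])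

lemma holomorphic_phi: "phi holomorphic_on ball 0 1"
  by (rule power_series_holomorphic[where a = a]) (simp add: sums_phi)

lemma measurable_phi [measurable]: "phi \<in> borel_measurable borel"
  unfolding phi_def[abs_def] by measurable

text \<open>Up to the factor \<open>2 \<pi>\<close>, the defect at \<open>r\<close> is the squared
  \<open>L\<^sup>2\<close> distance on the circle between the dilation \<open>z \<mapsto> phi (r
  z)\<close> and the boundary function; it vanishes as \<open>r\<close> tends to 1.\<close>

definition defect :: "real \<Rightarrow> real"
  where "defect r = (\<Sum>n. (cmod (a n))\<^sup>2 * (1 - r ^ n)\<^sup>2)"

lemma defect_term_le:
  assumes "0 \<le> r" "r \<le> 1"
  shows "(cmod (a n))\<^sup>2 * (1 - r ^ n)\<^sup>2 \<le> (cmod (a n))\<^sup>2"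
proof -
  have "(1 - r ^ n)\<^sup>2 \<le> 1\<^sup>2"
    using assms by (intro power_mono) (simp_all add: power_le_one)
  then show ?thesis
    by (simp add: mult_left_le)
qed

lemma summable_defect:
  assumes "0 \<le> r" "r \<le> 1"
  shows "summable (\<lambda>n. (cmod (a n))\<^sup>2 * (1 - r ^ n)\<^sup>2)"
  by (rule summable_comparison_test[OF _ square_summable]) (use defect_term_le[OF assms] in auto)

lemma tendsto_defect: "(defect \<longlongrightarrow> 0) (at_left 1)"
proof -
  have "((\<lambda>r. \<Sum>n. (cmod (a n))\<^sup>2 * (1 - r ^ n)\<^sup>2) \<longlongrightarrow> (\<Sum>n. (cmod (a n))\<^sup>2 * (1 - 1 ^ n)\<^sup>2)) (at_left (1::real))"
  proof (rule tannerys_theorem[THEN conjunct2, THEN conjunct2])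
    show "((\<lambda>r. (cmod (a n))\<^sup>2 * (1 - r ^ n)\<^sup>2) \<longlongrightarrow> (cmod (a n))\<^sup>2 * (1 - 1 ^ n)\<^sup>2) (at_left (1::real))" for n
      by (intro tendsto_intros)
    have "\<forall>\<^sub>F r in at_left (1::real). r \<in> {0<..<1}"
      by (rule eventually_at_leftI[of 0]) auto
    then have "\<forall>\<^sub>F (n :: nat, r) in at_top \<times>\<^sub>F at_left (1::real). r \<in> {0<..<1}"
      by (subst eventually_prod2) (simp_all add: trivial_limit_sequentially)
    then show "\<forall>\<^sub>F (n, r) in at_top \<times>\<^sub>F at_left (1::real). norm ((cmod (a n))\<^sup>2 * (1 - r ^ n)\<^sup>2) \<le> (cmod (a n))\<^sup>2"
      by eventually_elim (auto simp: defect_term_le)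
  qed (simp_all add: square_summable)
  then show ?thesis
    by (simp add: defect_def[abs_def])
qed

lemma dilation_L2_distance:
  assumes r: "0 \<le> r" "r < 1" and s: "0 \<le> s" "s < 1"
  shows "circle_integral (\<lambda>z. ennreal ((cmod (phi (r *\<^sub>R z) - phi (s *\<^sub>R z)))\<^sup>2))
    \<le> ennreal (4 * pi * (defect r + defect s))"
proof -
  define c where "c n = a n * of_real (r ^ n - s ^ n)" for n
  have bound: "(cmod (c n))\<^sup>2 \<le> 2 * ((cmod (a n))\<^sup>2 * (1 - r ^ n)\<^sup>2) + 2 * ((cmod (a n))\<^sup>2 * (1 - s ^ n)\<^sup>2)" for n
  proof -
    have "(r ^ n - s ^ n)\<^sup>2 \<le> 2 * (1 - r ^ n)\<^sup>2 + 2 * (1 - s ^ n)\<^sup>2"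
      using zero_le_power2[of "(1 - r ^ n) + (1 - s ^ n)"]
      by (simp add: power2_eq_square algebra_simps)
    then have "(cmod (a n))\<^sup>2 * (r ^ n - s ^ n)\<^sup>2 \<le> (cmod (a n))\<^sup>2 * (2 * (1 - r ^ n)\<^sup>2 + 2 * (1 - s ^ n)\<^sup>2)"
      by (rule mult_left_mono) simp
    moreover have "(cmod (c n))\<^sup>2 = (cmod (a n))\<^sup>2 * (r ^ n - s ^ n)\<^sup>2"
      by (simp only: c_def norm_mult norm_of_real power_mult_distrib power2_abs)
    ultimately show ?thesis
      by (simp add: distrib_left mult_ac)
  qed
  have sr: "(\<lambda>n. (cmod (a n))\<^sup>2 * (1 - r ^ n)\<^sup>2) sums defect r" and ss: "(\<lambda>n. (cmod (a n))\<^sup>2 * (1 - s ^ n)\<^sup>2) sums defect s"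
    unfolding defect_def using r s by (auto intro!: summable_sums summable_defect)
  have sum2: "(\<lambda>n. 2 * ((cmod (a n))\<^sup>2 * (1 - r ^ n)\<^sup>2) + 2 * ((cmod (a n))\<^sup>2 * (1 - s ^ n)\<^sup>2)) sums (2 * defect r + 2 * defect s)"
    by (intro sums_add sums_mult sr ss)
  have c: "summable (\<lambda>n. (cmod (c n))\<^sup>2)"
    by (rule summable_comparison_test[OF _ sums_summable[OF sum2]]) (use bound in auto)
  have "(\<Sum>n. (cmod (c n))\<^sup>2) \<le> 2 * defect r + 2 * defect s"
    using suminf_le[OF bound c sums_summable[OF sum2]] sums_unique[OF sum2] by simp
  moreover have "circle_integral (\<lambda>z. ennreal ((cmod (phi (r *\<^sub>R z) - phi (s *\<^sub>R z)))\<^sup>2))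
      \<le> ennreal (2 * pi * (\<Sum>n. (cmod (c n))\<^sup>2))"
  proof (rule parseval_le[OF _ c])
    fix z :: complex assume z: "cmod z = 1"
    have "(\<lambda>n. a n * (r *\<^sub>R z) ^ n - a n * (s *\<^sub>R z) ^ n) sums (phi (r *\<^sub>R z) - phi (s *\<^sub>R z))"
      using z r s by (intro sums_diff sums_phi) simp_all
    then show "(\<lambda>n. c n * z ^ n) sums (phi (r *\<^sub>R z) - phi (s *\<^sub>R z))"
      by (simp add: c_def scaleR_conv_of_real power_mult_distrib algebra_simps)
  qed
  moreover have "2 * pi * x \<le> 4 * pi * (defect r + defect s)" if "x \<le> 2 * defect r + 2 * defect s" for x
    using mult_left_mono[OF that, of "2 * pi"] by (simp add: algebra_simps)
  ultimately show ?thesis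
    by (meson ennreal_leI order.trans)
qed

lemma circle_integral_mono:
  assumes "\<And>z. cmod z = 1 \<Longrightarrow> u z \<le> v z"
  shows "circle_integral u \<le> circle_integral v"
  unfolding circle_integral_def by (intro nn_integral_mono mult_right_mono assms) simp_all

lemma circle_integral_const: "circle_integral (\<lambda>z. ennreal x) = ennreal (2 * pi) * ennreal x"
  unfolding circle_integral_def by (simp add: nn_integral_cmult mult.commute)

lemma circle_integral_add:
  assumes [measurable]: "u \<in> borel_measurable borel" "v \<in> borel_measurable borel"
  shows "circle_integral (\<lambda>z. u z + v z) = circle_integral u + circle_integral v"
  unfolding circle_integral_def by (simp add: distrib_right nn_integral_add)

lemma circle_integral_multc:
  assumes [measurable]: "u \<in> borel_measurable borel"
  shows "circle_integral (\<lambda>z. u z * c) = circle_integral u * c"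
  unfolding circle_integral_def by (subst nn_integral_multc[symmetric]) (simp_all add: mult_ac)

text \<open>The passage from \<open>L\<^sup>2\<close> to \<open>L\<^sup>1\<close> uses \<open>x \<le> d /
  2 + x\<^sup>2 / (2 d)\<close> with \<open>d\<close> of the size of the
  \<open>L\<^sup>2\<close> distance, in place of the Cauchy-Schwarz inequality.\<close>

lemma dilation_L1_distance:
  assumes r: "0 \<le> r" "r < 1" and s: "0 \<le> s" "s < 1"
    and d: "0 < d" "defect r \<le> d\<^sup>2" "defect s \<le> d\<^sup>2"
  shows "circle_integral (\<lambda>z. ennreal (cmod (phi (r *\<^sub>R z) - phi (s *\<^sub>R z)))) \<le> ennreal (5 * pi * d)"
proof -
  let ?D = "\<lambda>z. cmod (phi (r *\<^sub>R z) - phi (s *\<^sub>R z))"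
  have le: "x \<le> d / 2 + x\<^sup>2 * (1 / (2 * d))" for x
  proof -
    have "2 * x * d \<le> d\<^sup>2 + x\<^sup>2"
      using zero_le_power2[of "x - d"] by (simp add: power2_eq_square algebra_simps)
    then show ?thesis
      using d by (simp add: field_simps power2_eq_square)
  qed
  have "circle_integral (\<lambda>z. ennreal (?D z)) \<le> circle_integral (\<lambda>z. ennreal (d / 2) + ennreal ((?D z)\<^sup>2) * ennreal (1 / (2 * d)))"
    using d le by (intro circle_integral_mono)
      (simp add: ennreal_plus[symmetric] ennreal_mult[symmetric] ennreal_leI del: ennreal_plus)
  also have "\<dots> = circle_integral (\<lambda>z. ennreal (d / 2)) + circle_integral (\<lambda>z. ennreal ((?D z)\<^sup>2)) * ennreal (1 / (2 * d))"
    by (simp add: circle_integral_add circle_integral_multc)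
  also have "\<dots> \<le> ennreal (2 * pi) * ennreal (d / 2) + ennreal (4 * pi * (defect r + defect s)) * ennreal (1 / (2 * d))"
    unfolding circle_integral_const
    by (intro add_mono mult_right_mono dilation_L2_distance r s) simp_all
  also have "\<dots> \<le> ennreal (2 * pi) * ennreal (d / 2) + ennreal (4 * pi * (d\<^sup>2 + d\<^sup>2)) * ennreal (1 / (2 * d))"
    using d by (intro add_mono mult_right_mono ennreal_leI mult_left_mono) simp_all
  also have "\<dots> = ennreal (5 * pi * d)"
    using d by (simp add: ennreal_mult[symmetric] ennreal_plus[symmetric] power2_eq_square del: ennreal_plus)
  finally show ?thesis .
qed

lemma good_radii_exist: "\<exists>\<rho>. \<forall>k::nat. 0 \<le> \<rho> k \<and> \<rho> k < 1 \<and> 1 - 1 / real (Suc k) < \<rho> k \<and> defect (\<rho> k) \<le> ((1 / 2) ^ k)\<^sup>2"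
proof -
  have "\<exists>r. 0 \<le> r \<and> r < 1 \<and> 1 - 1 / real (Suc k) < r \<and> defect r \<le> ((1 / 2) ^ k)\<^sup>2" for k
  proof -
    have "\<forall>\<^sub>F r in at_left 1. defect r < ((1 / 2) ^ k)\<^sup>2"
      by (rule order_tendstoD(2)[OF tendsto_defect]) simp
    moreover have "\<forall>\<^sub>F r in at_left 1. r \<in> {1 - 1 / real (Suc k)<..<1}"
      by (rule eventually_at_leftI[of "1 - 1 / real (Suc k)"]) auto
    ultimately have "\<forall>\<^sub>F r in at_left 1. defect r < ((1 / 2) ^ k)\<^sup>2 \<and> r \<in> {1 - 1 / real (Suc k)<..<1}"
      by eventually_elim simp
    then obtain r where "defect r < ((1 / 2) ^ k)\<^sup>2" "r \<in> {1 - 1 / real (Suc k)<..<1}"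
      using eventually_happens trivial_limit_at_left_real by blast
    moreover have "1 / real (Suc k) \<le> 1" by simp
    ultimately have "0 \<le> r \<and> r < 1 \<and> 1 - 1 / real (Suc k) < r \<and> defect r \<le> ((1 / 2) ^ k)\<^sup>2"
      unfolding greaterThanLessThan_iff by linarith
    then show ?thesis ..
  qed
  then show ?thesis by metis
qed

text \<open>Radii tending to 1 so fast that the successive \<open>L\<^sup>1\<close> distances of the
  dilations are summable.\<close>

definition rad :: "nat \<Rightarrow> real"
  where "rad = (SOME \<rho>. \<forall>k::nat. 0 \<le> \<rho> k \<and> \<rho> k < 1 \<and> 1 - 1 / real (Suc k) < \<rho> k \<and> defect (\<rho> k) \<le> ((1 / 2) ^ k)\<^sup>2)"

lemma rad: "0 \<le> rad k" "rad k < 1" "1 - 1 / real (Suc k) < rad k" "defect (rad k) \<le> ((1 / 2) ^ k)\<^sup>2"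
  using someI_ex[OF good_radii_exist] unfolding rad_def by blast+

lemma tendsto_rad: "rad \<longlonglongrightarrow> 1"
proof (rule real_tendsto_sandwich)
  show "(\<lambda>k. 1 - 1 / real (Suc k)) \<longlonglongrightarrow> 1"
    using tendsto_diff[OF tendsto_const LIMSEQ_inverse_real_of_nat, of "1::real"] by (simp add: inverse_eq_divide)
  show "\<forall>\<^sub>F k in sequentially. 1 - 1 / real (Suc k) \<le> rad k" "\<forall>\<^sub>F k in sequentially. rad k \<le> 1"
    using rad by (auto intro!: always_eventually less_imp_le)
qed simp

text \<open>The boundary function, as the limit of \<open>phi\<close> along the radii \<open>rad
  k\<close>. It is a measurable function on the whole plane, meaningful at almost every point of
  the circle. The full radial limit is identified with it by Fatou's theorem below.\<close>

definition boundary_value :: "complex \<Rightarrow> complex"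
  where "boundary_value z = lim (\<lambda>k. phi (rad k *\<^sub>R z))"

lemma measurable_boundary_value [measurable]: "boundary_value \<in> borel_measurable borel"
  unfolding boundary_value_def[abs_def] by measurable

lemma AE_boundary_value: "AE t in lborel. (\<lambda>k. phi (rad k *\<^sub>R cis t)) \<longlonglongrightarrow> boundary_value (cis t)"
proof (rule AE_line_if_circle)
  let ?d = "\<lambda>k z. cmod (phi (rad (Suc k) *\<^sub>R z) - phi (rad k *\<^sub>R z))"
  have "(\<integral>\<^sup>+ t. (\<Sum>k. ennreal (?d k (cis t)) * indicator {0..2 * pi} t) \<partial>lborel) =
      (\<Sum>k. circle_integral (\<lambda>z. ennreal (?d k z)))"
    unfolding circle_integral_def by (rule nn_integral_suminf) simp
  also have "\<dots> \<le> (\<Sum>k. ennreal (5 * pi * (1 / 2) ^ k))"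
  proof (intro suminf_le allI dilation_L1_distance rad)
    fix k
    have "((1 / 2) ^ Suc k)\<^sup>2 \<le> ((1 / 2 :: real) ^ k)\<^sup>2"
      by (intro power_mono) simp_all
    then show "defect (rad (Suc k)) \<le> ((1 / 2) ^ k)\<^sup>2"
      using rad(4)[of "Suc k"] by linarith
  qed simp_all
  also have "\<dots> = ennreal (\<Sum>k. 5 * pi * (1 / 2) ^ k)"
    by (intro suminf_ennreal2 summable_mult summable_geometric) simp_all
  also have "\<dots> < \<infinity>" by simp
  finally have "(\<integral>\<^sup>+ t. (\<Sum>k. ennreal (?d k (cis t)) * indicator {0..2 * pi} t) \<partial>lborel) \<noteq> \<infinity>"
    by simp
  then have "AE t in lborel. (\<Sum>k. ennreal (?d k (cis t)) * indicator {0..2 * pi} t) \<noteq> \<infinity>"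
    by (intro nn_integral_PInf_AE) simp_all
  then show "AE t in lborel. t \<in> {0..2 * pi} \<longrightarrow> (\<lambda>k. phi (rad k *\<^sub>R cis t)) \<longlonglongrightarrow> boundary_value (cis t)"
  proof eventually_elim
    case (elim t)
    show ?case
    proof
      assume "t \<in> {0..2 * pi}"
      with elim have "(\<Sum>k. ennreal (?d k (cis t))) \<noteq> top" by simp
      then have "summable (\<lambda>k. ?d k (cis t))"
        by (intro summable_suminf_not_top) simp_all
      then have "convergent (\<lambda>n. \<Sum>k<n. phi (rad (Suc k) *\<^sub>R cis t) - phi (rad k *\<^sub>R cis t))"
        unfolding summable_iff_convergent[symmetric] by (rule summable_norm_cancel)
      then have "convergent (\<lambda>n. (phi (rad n *\<^sub>R cis t) - phi (rad 0 *\<^sub>R cis t)) + phi (rad 0 *\<^sub>R cis t))"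
        by (intro convergent_add convergent_const) (simp add: sum_lessThan_telescope[where f = "\<lambda>n. phi (rad n *\<^sub>R cis t)"])
      then show "(\<lambda>k. phi (rad k *\<^sub>R cis t)) \<longlonglongrightarrow> boundary_value (cis t)"
        unfolding boundary_value_def by (simp add: convergent_LIMSEQ_iff)
    qed
  qed
qed

lemma boundary_value_L1: "circle_integral (\<lambda>z. ennreal (cmod (phi (rad k *\<^sub>R z) - boundary_value z))) \<le> ennreal (5 * pi * (1 / 2) ^ k)"
proof -
  let ?D = "\<lambda>j z. ennreal (cmod (phi (rad k *\<^sub>R z) - phi (rad j *\<^sub>R z)))"
  have "circle_integral (\<lambda>z. ennreal (cmod (phi (rad k *\<^sub>R z) - boundary_value z))) =
     (\<integral>\<^sup>+ t. liminf (\<lambda>j. ?D j (cis t) * indicator {0..2 * pi} t) \<partial>lborel)"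
    unfolding circle_integral_def
  proof (rule nn_integral_cong_AE)
    show "AE t in lborel. ennreal (cmod (phi (rad k *\<^sub>R cis t) - boundary_value (cis t))) * indicator {0..2 * pi} t
        = liminf (\<lambda>j. ?D j (cis t) * indicator {0..2 * pi} t)"
      using AE_boundary_value
    proof eventually_elim
      case (elim t)
      have "(\<lambda>j. ?D j (cis t)) \<longlonglongrightarrow> ennreal (cmod (phi (rad k *\<^sub>R cis t) - boundary_value (cis t)))"
        by (intro tendsto_ennrealI tendsto_intros elim)
      then have "liminf (\<lambda>j. ?D j (cis t)) = ennreal (cmod (phi (rad k *\<^sub>R cis t) - boundary_value (cis t)))"
        by (intro lim_imp_Liminf) simp_all
      then show ?case by (cases "t \<in> {0..2*pi}") (simp_all add: Liminf_const)
    qed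
  qed
  also have "\<dots> \<le> liminf (\<lambda>j. \<integral>\<^sup>+ t. ?D j (cis t) * indicator {0..2 * pi} t \<partial>lborel)"
    by (rule nn_integral_liminf) simp
  also have "\<dots> \<le> liminf (\<lambda>j::nat. ennreal (5 * pi * (1 / 2) ^ k))"
  proof (rule Liminf_mono)
    show "\<forall>\<^sub>F j in sequentially. (\<integral>\<^sup>+ t. ?D j (cis t) * indicator {0..2 * pi} t \<partial>lborel) \<le> ennreal (5 * pi * (1 / 2) ^ k)"
      using eventually_ge_at_top[of k]
    proof eventually_elim
      case (elim j)
      have "((1 / 2) ^ j)\<^sup>2 \<le> ((1 / 2 :: real) ^ k)\<^sup>2"
        using elim by (intro power_mono power_decreasing) simp_all
      then have "defect (rad j) \<le> ((1 / 2) ^ k)\<^sup>2"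
        using rad(4)[of j] by linarith
      then show ?case
        by (intro dilation_L1_distance[unfolded circle_integral_def] rad) simp_all
    qed
  qed
  finally show ?thesis by (simp add: Liminf_const)
qed

end

section \<open>The Poisson kernel\<close>

text \<open>The Poisson kernel of the disc for the point \<open>r\<close> of the real axis, as a function
  of the angle; its total mass is \<open>2 \<pi>\<close>.\<close>

definition poisson :: "real \<Rightarrow> real \<Rightarrow> real"
  where "poisson r s = (1 - r\<^sup>2) / (1 - 2 * r * cos s + r\<^sup>2)"

text \<open>The negative of the derivative of the Poisson kernel; it is nonnegative on
  \<open>{0..\<pi>}\<close>.\<close>

definition poisson_slope :: "real \<Rightarrow> real \<Rightarrow> real"
  where "poisson_slope r s = (1 - r\<^sup>2) * (2 * r * sin s) / (1 - 2 * r * cos s + r\<^sup>2)\<^sup>2"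

lemma poisson_denominator_pos:
  assumes "0 \<le> r" "r < (1::real)"
  shows "0 < 1 - 2 * r * cos s + r\<^sup>2"
proof -
  have "0 < (1 - r)\<^sup>2"
    using assms by simp
  also have "\<dots> \<le> 1 - 2 * r * cos s + r\<^sup>2"
    using assms mult_left_mono[OF cos_le_one[of s], of "2 * r"] by (simp add: power2_eq_square algebra_simps)
  finally show ?thesis .
qed

lemma poisson_deriv:
  assumes "0 \<le> r" "r < 1"
  shows "(poisson r has_vector_derivative - poisson_slope r s) (at s)"
  unfolding has_real_derivative_iff_has_vector_derivative[symmetric] poisson_def[abs_def] poisson_slope_def
  using poisson_denominator_pos[OF assms, of s]
  by (auto intro!: derivative_eq_intros simp: power2_eq_square)

lemma continuous_poisson_slope:
  assumes "0 \<le> r" "r < 1"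
  shows "continuous_on S (poisson_slope r)"
  unfolding poisson_slope_def[abs_def]
  by (intro continuous_intros) (use poisson_denominator_pos[OF assms] in \<open>simp add: less_imp_neq[symmetric]\<close>)

lemma continuous_poisson:
  assumes "0 \<le> r" "r < 1"
  shows "continuous_on S (poisson r)"
  unfolding poisson_def[abs_def]
  by (intro continuous_intros) (use poisson_denominator_pos[OF assms] in \<open>simp add: less_imp_neq[symmetric]\<close>)

lemma poisson_kernel_eq:
  assumes r: "0 \<le> r" "r < 1" and c: "cmod c = 1"
  shows "c / (c - of_real r) + of_real r * c / (1 - of_real r * c) = of_real ((1 - r\<^sup>2) / (1 - 2 * r * Re c + r\<^sup>2))"
proof -
  have cc: "c * cnj c = 1"
    using c by (simp add: complex_norm_square[symmetric])
  have n1: "c - of_real r \<noteq> 0"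
    using r c by (auto dest: arg_cong[of _ _ cmod])
  have n2: "1 - of_real r * c \<noteq> 0"
    using r c by (auto dest!: arg_cong[of _ _ cmod] simp: norm_mult)
  have d: "(c - of_real r) * (1 - of_real r * c) = c * of_real (1 - 2 * r * Re c + r\<^sup>2)"
  proof -
    have "c * of_real (2 * Re c) = c * c + c * cnj c"
      by (simp add: complex_add_cnj[symmetric] distrib_left del: of_real_mult)
    then have *: "c * (2 * of_real (Re c)) = c * c + 1"
      by (simp add: cc)
    have "c * of_real (1 - 2 * r * Re c + r\<^sup>2) = c - of_real r * (c * (2 * of_real (Re c))) + of_real r * of_real r * c"
      by (simp add: power2_eq_square algebra_simps)
    also have "\<dots> = (c - of_real r) * (1 - of_real r * c)"
      unfolding * by (simp add: algebra_simps)
    finally show ?thesis by simp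
  qed
  have c0: "c \<noteq> 0" using c by auto
  have "c / (c - of_real r) + of_real r * c / (1 - of_real r * c)
      = (c * of_real (1 - r\<^sup>2)) / ((c - of_real r) * (1 - of_real r * c))"
    using n1 n2 by (simp add: field_simps power2_eq_square)
  also have "\<dots> = of_real (1 - r\<^sup>2) / of_real (1 - 2 * r * Re c + r\<^sup>2)"
    unfolding d using c0 by (rule mult_divide_mult_cancel_left)
  finally show ?thesis by simp
qed

text \<open>The Poisson formula at a real point, from Cauchy's formula for \<open>F\<close> at
  \<open>r\<close> and for \<open>F(w) r w / (1 - r w)\<close> at 0. The contour is rotated by a
  half turn, since the standard circle is parametrised over \<open>{0..2 \<pi>}\<close> and the
  symmetric interval is needed.\<close>

lemma poisson_formula:
  fixes F :: "complex \<Rightarrow> complex"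
  assumes F: "F holomorphic_on cball 0 1" and r: "0 \<le> r" "r < 1"
  shows "((\<lambda>s. poisson r s *\<^sub>R F (cis s)) has_integral 2 * pi * F (of_real r)) {- pi..pi}"
proof -
  have F': "(\<lambda>u. F (- u)) holomorphic_on cball 0 1"
    by (rule holomorphic_on_compose_gen[OF _ F, unfolded o_def]) (auto intro!: holomorphic_intros)
  have nz: "1 + of_real r * u \<noteq> 0" if "u \<in> cball 0 1" for u :: complex
  proof
    assume "1 + of_real r * u = 0"
    then have "cmod (of_real r * u) = 1"
      by (metis add_eq_0_iff norm_minus_cancel norm_one)
    moreover have "cmod (of_real r * u) \<le> r * 1"
      unfolding norm_mult using r that by (intro mult_mono) auto
    ultimately show False using r by simp
  qed
  have H': "(\<lambda>u. F (- u) * (- (of_real r * u) / (1 + of_real r * u))) holomorphic_on cball 0 1"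
    by (intro holomorphic_intros F') (use nz in auto)
  have "((\<lambda>u. F (- u) / (u - (- of_real r))) has_contour_integral 2 * of_real pi * \<i> * F (- (- of_real r))) (circlepath 0 1)"
    by (rule Cauchy_integral_circlepath_simple[OF F']) (use r in simp)
  then have 1: "((\<lambda>t. F (- cis t) / (cis t + of_real r) * \<i> * cis t) has_integral 2 * pi * \<i> * F (of_real r)) {0..2 * pi}"
    unfolding circlepath_def by (subst (asm) has_contour_integral_part_circlepath_iff) simp_all
  have "((\<lambda>u. F (- u) * (- (of_real r * u) / (1 + of_real r * u)) / (u - 0)) has_contour_integral
      2 * of_real pi * \<i> * (F (- 0) * (- (of_real r * 0) / (1 + of_real r * 0)))) (circlepath 0 1)"
    by (rule Cauchy_integral_circlepath_simple[OF H']) simp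
  then have 2: "((\<lambda>t. F (- cis t) * (- (of_real r * cis t) / (1 + of_real r * cis t)) / cis t * \<i> * cis t) has_integral 0) {0..2 * pi}"
    unfolding circlepath_def by (subst (asm) has_contour_integral_part_circlepath_iff) simp_all
  have "((\<lambda>t. (F (- cis t) / (cis t + of_real r) * \<i> * cis t
      + F (- cis t) * (- (of_real r * cis t) / (1 + of_real r * cis t)) / cis t * \<i> * cis t) / \<i>)
      has_integral (2 * pi * \<i> * F (of_real r) + 0) / \<i>) {0..2 * pi}"
    by (intro has_integral_divide has_integral_add 1 2)
  also have "(\<lambda>t. (F (- cis t) / (cis t + of_real r) * \<i> * cis t
      + F (- cis t) * (- (of_real r * cis t) / (1 + of_real r * cis t)) / cis t * \<i> * cis t) / \<i>) =
      (\<lambda>t. poisson r (t - pi) *\<^sub>R F (cis (t - pi)))"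
  proof
    fix t
    define c where "c = - cis t"
    have c: "cis t = - c" "cis (t - pi) = c" "cos (t - pi) = Re c" "c \<noteq> 0"
      by (simp_all add: c_def cis_divide[symmetric])
    have "(F c / (- c + of_real r) * \<i> * (- c) + F c * (of_real r * c / (1 - of_real r * c)) / (- c) * \<i> * (- c)) / \<i>
       = F c * (c / (c - of_real r) + of_real r * c / (1 - of_real r * c))"
    proof -
      have a: "- c + of_real r = - (c - of_real r)" by simp
      have "F c / (- c + of_real r) * \<i> * (- c) = F c * (c / (c - of_real r)) * \<i>"
        unfolding a divide_minus_right by simp
      moreover have "x / (- c) * \<i> * (- c) = x * \<i>" for x
        using c(4) by simp
      ultimately show ?thesis
        by (simp only: distrib_left distrib_right add_divide_distrib nonzero_mult_div_cancel_right[OF complex_i_not_zero])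
    qed
    also have "\<dots> = F c * of_real (poisson r (t - pi))"
      using r by (subst poisson_kernel_eq) (simp_all add: poisson_def c(3)[symmetric] c_def)
    finally show "(F (- cis t) / (cis t + of_real r) * \<i> * cis t
      + F (- cis t) * (- (of_real r * cis t) / (1 + of_real r * cis t)) / cis t * \<i> * cis t) / \<i> =
      poisson r (t - pi) *\<^sub>R F (cis (t - pi))"
      by (simp add: c scaleR_conv_of_real mult.commute)
  qed
  also have "(2 * pi * \<i> * F (of_real r) + 0) / \<i> = 2 * pi * F (of_real r)"
    by (simp add: field_simps)
  finally have "((\<lambda>t. poisson r (t - pi) *\<^sub>R F (cis (t - pi))) has_integral 2 * pi * F (of_real r)) {0..2 * pi}" .
  then show ?thesis
    using has_integral_shift_Icc_real[of "\<lambda>s. poisson r s *\<^sub>R F (cis s)" "- pi" "2 * pi * F (of_real r)" 0 "2 * pi"]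
    by (simp add: o_def)
qed

text \<open>After integration by parts the Poisson formula involves \<open>F\<close> only through its
  symmetric means. This form survives passing to the \<open>L\<^sup>1\<close> boundary function.\<close>

lemma poisson_formula_by_parts:
  fixes F :: "complex \<Rightarrow> complex"
  assumes F: "F holomorphic_on cball 0 1" and r: "0 \<le> r" "r < 1"
  shows "((\<lambda>x. poisson_slope r x *\<^sub>R integral {- x..x} (\<lambda>s. F (cis s))) has_integral
    2 * pi * F (of_real r) - poisson r pi *\<^sub>R integral {- pi..pi} (\<lambda>s. F (cis s))) {0..pi}"
proof -
  let ?f = "\<lambda>s. F (cis s)"
  define E where "E x = integral {- x..x} ?f" for x
  have cf: "continuous_on S ?f" for S
    by (rule continuous_on_compose2[OF holomorphic_on_imp_continuous_on[OF F]]) (auto intro!: continuous_intros)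
  then have cf': "continuous_on S (\<lambda>s. ?f (- s))" for S
    by (intro continuous_on_compose2[OF cf[of UNIV]] continuous_intros) auto
  have int: "?f integrable_on {a..b}" for a b
    by (intro integrable_continuous_real cf)
  have refl: "integral {- x..0} g = integral {0..x} (\<lambda>s. g (- s))" for x and g :: "real \<Rightarrow> complex"
    using Henstock_Kurzweil_Integration.integral_reflect_real[where a = 0 and b = x and f = "\<lambda>s. g (- s)"] by simp
  have E: "E x = integral {0..x} (\<lambda>s. ?f (- s)) + integral {0..x} ?f" if "0 \<le> x" for x
    unfolding E_def using that
    by (subst Henstock_Kurzweil_Integration.integral_combine[symmetric, where c = 0]) (auto simp: refl int)
  have derE: "(E has_vector_derivative (?f (- x) + ?f x)) (at x within {0..pi})" if "x \<in> {0..pi}" for x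
  proof (rule has_vector_derivative_transform[OF that])
    show "((\<lambda>x. integral {0..x} (\<lambda>s. ?f (- s)) + integral {0..x} ?f) has_vector_derivative (?f (- x) + ?f x)) (at x within {0..pi})"
      by (intro has_vector_derivative_add integral_has_vector_derivative that cf cf')
  qed (use E in auto)
  have contE: "continuous_on {0..pi} E"
    unfolding continuous_on_eq_continuous_within using derE has_vector_derivative_continuous by blast
  let ?y = "poisson r pi *\<^sub>R E pi - 2 * pi * F (of_real r)"
  have pf: "(\<lambda>s. poisson r s *\<^sub>R ?f s) integrable_on {a..b}" for a b
    by (intro integrable_continuous_real continuous_intros continuous_poisson r cf)
  have pint: "((\<lambda>x. poisson r x *\<^sub>R (?f (- x) + ?f x)) has_integral 2 * pi * F (of_real r)) {0..pi}"
  proof -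
    have "2 * pi * F (of_real r) = integral {- pi..pi} (\<lambda>s. poisson r s *\<^sub>R ?f s)"
      using poisson_formula[OF F r] by (simp add: integral_unique)
    also have "\<dots> = integral {- pi..0} (\<lambda>s. poisson r s *\<^sub>R ?f s) + integral {0..pi} (\<lambda>s. poisson r s *\<^sub>R ?f s)"
      by (subst Henstock_Kurzweil_Integration.integral_combine[symmetric, where c = 0]) (auto simp: pf)
    also have "integral {- pi..0} (\<lambda>s. poisson r s *\<^sub>R ?f s) = integral {0..pi} (\<lambda>s. poisson r s *\<^sub>R ?f (- s))"
      by (subst refl) (simp add: poisson_def)
    finally have eq: "2 * pi * F (of_real r) = \<dots> + integral {0..pi} (\<lambda>s. poisson r s *\<^sub>R ?f s)" .
    show ?thesis
      unfolding eq scaleR_add_right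
      by (intro has_integral_add integrable_integral pf) 
        (intro integrable_continuous_real continuous_intros continuous_poisson r cf')
  qed
  have "((\<lambda>x. (- poisson_slope r x) *\<^sub>R E x) has_integral ?y) {0..pi}"
  proof (rule integration_by_parts_interior[OF bounded_bilinear_scaleR, of 0 pi "poisson r" E "\<lambda>x. - poisson_slope r x" "\<lambda>x. ?f (- x) + ?f x" ?y])
    show "(poisson r has_vector_derivative - poisson_slope r x) (at x)" for x
      using r by (rule poisson_deriv)
    show "(E has_vector_derivative ?f (- x) + ?f x) (at x)" if "x \<in> {0<..<pi}" for x
      using derE[of x] that at_within_interior[of x "{0..pi}"] by (simp add: interior_atLeastAtMost_real)
    have "E 0 = 0" by (simp add: E_def)
    then show "((\<lambda>x. poisson r x *\<^sub>R (?f (- x) + ?f x)) has_integral poisson r pi *\<^sub>R E pi - poisson r 0 *\<^sub>R E 0 - ?y) {0..pi}"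
      using pint by simp
  qed (auto simp: contE continuous_poisson r)
  then have "((\<lambda>x. - ((- poisson_slope r x) *\<^sub>R E x)) has_integral - ?y) {0..pi}"
    by (rule has_integral_neg)
  then show ?thesis
    by (simp add: E_def)
qed

text \<open>The case \<open>F = 1\<close>: total mass of the kernel acting on symmetric means.\<close>

lemma poisson_slope_total:
  assumes "0 \<le> r" "r < 1"
  shows "((\<lambda>x. poisson_slope r x * (2 * x)) has_integral 2 * pi - poisson r pi * (2 * pi)) {0..pi}"
proof -
  have "((\<lambda>x. poisson_slope r x *\<^sub>R integral {- x..x} (\<lambda>s. 1 :: complex)) has_integral
      2 * pi * (1 :: complex) - poisson r pi *\<^sub>R integral {- pi..pi} (\<lambda>s. 1)) {0..pi}"
    by (rule poisson_formula_by_parts[OF _ assms]) simp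
  then have "((\<lambda>x. poisson_slope r x *\<^sub>R (of_real (2 * x) :: complex)) has_integral
      2 * pi * (1 :: complex) - poisson r pi *\<^sub>R integral {- pi..pi} (\<lambda>s. 1)) {0..pi}"
    by (rule has_integral_eq[rotated]) (simp add: scaleR_conv_of_real)
  from has_integral_linear[OF this bounded_linear_Re] show ?thesis
    by (simp add: o_def scaleR_conv_of_real)
qed

lemma poisson_slope_le:
  assumes r: "0 \<le> r" "r < 1" and d: "0 < d" "d \<le> pi / 2" and x: "d \<le> x" "x \<le> pi"
  shows "poisson_slope r x \<le> 2 * (1 - r\<^sup>2) / (sin d) ^ 4"
proof -
  have r2: "0 \<le> 1 - r\<^sup>2" using r by (simp add: power_le_one)
  have s: "0 \<le> sin x" using d x by (intro sin_ge_zero) auto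
  have sd: "0 < sin d" using d by (intro sin_gt_zero) (use pi_gt_zero in linarith)+
  have "cos x \<le> cos d" using d x by (intro cos_monotone_0_pi_le) auto
  then have "2 * r * cos x \<le> 2 * r * cos d" using r by (intro mult_left_mono) auto
  moreover have "(sin d)\<^sup>2 \<le> 1 - 2 * r * cos d + r\<^sup>2"
    using zero_le_power2[of "r - cos d"] unfolding sin_squared_eq
    by (simp add: power2_eq_square algebra_simps)
  ultimately have den: "(sin d)\<^sup>2 \<le> 1 - 2 * r * cos x + r\<^sup>2" by linarith
  then have "((sin d)\<^sup>2)\<^sup>2 \<le> (1 - 2 * r * cos x + r\<^sup>2)\<^sup>2"
    by (intro power_mono) auto
  then have den4: "(sin d) ^ 4 \<le> (1 - 2 * r * cos x + r\<^sup>2)\<^sup>2"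
    by (simp flip: power_mult)
  have "2 * r * sin x \<le> 2 * 1 * 1"
    using r s by (intro mult_mono) auto
  then have "(1 - r\<^sup>2) * (2 * r * sin x) \<le> 2 * (1 - r\<^sup>2)"
    using mult_left_mono[OF _ r2, of "2 * r * sin x" 2] by simp
  then show ?thesis
    unfolding poisson_slope_def using den4 sd r2 by (intro frac_le) auto
qed

lemma poisson_slope_nonneg:
  assumes "0 \<le> r" "r < 1" "0 \<le> x" "x \<le> pi"
  shows "0 \<le> poisson_slope r x"
  using assms power_le_one[of r 2] unfolding poisson_slope_def
  by (intro divide_nonneg_nonneg mult_nonneg_nonneg sin_ge_zero) auto

text \<open>The analytic core of Fatou's theorem: if the symmetric means \<open>E x / (2 x)\<close>
  converge to \<open>L\<close> as \<open>x\<close> tends to 0, so do the Poisson means as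
  \<open>r\<close> tends to 1. The kernel is positive, of bounded mass, and concentrates at 0.\<close>

lemma poisson_means_tendsto:
  fixes u :: "real \<Rightarrow> complex" and E :: "real \<Rightarrow> complex"
  assumes u: "\<And>r. 0 \<le> r \<Longrightarrow> r < 1 \<Longrightarrow>
      ((\<lambda>x. poisson_slope r x *\<^sub>R E x) has_integral 2 * pi * u r - poisson r pi *\<^sub>R E pi) {0..pi}"
    and bounded: "\<And>x. x \<in> {0..pi} \<Longrightarrow> cmod (E x) \<le> C"
    and lim: "((\<lambda>x. E x /\<^sub>R x) \<longlongrightarrow> 2 * L) (at_right 0)"
  shows "(u \<longlongrightarrow> L) (at_left 1)"
proof -
  define M where "M = C + 2 * pi * cmod L"
  have "0 \<le> C" using bounded[of 0] by (auto intro: order.trans[OF norm_ge_zero])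
  then have M: "0 \<le> M" by (simp add: M_def)
  have EM: "cmod (E x - of_real (2 * x) * L) \<le> M" if "x \<in> {0..pi}" for x
  proof -
    have "cmod (E x - of_real (2 * x) * L) \<le> cmod (E x) + cmod (of_real (2 * x) * L)"
      by (rule norm_triangle_ineq4)
    also have "cmod (of_real (2 * x) * L) = 2 * x * cmod L"
      using that by (simp add: norm_mult)
    also have "\<dots> \<le> 2 * pi * cmod L"
      using that by (intro mult_right_mono) auto
    finally show ?thesis using bounded[OF that] by (simp add: M_def)
  qed
  have diff: "((\<lambda>x. poisson_slope r x *\<^sub>R (E x - of_real (2 * x) * L)) has_integral
     2 * pi * (u r - L) - poisson r pi *\<^sub>R (E pi - of_real (2 * pi) * L)) {0..pi}" if r: "0 \<le> r" "r < 1" for r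
  proof -
    have "((\<lambda>x. poisson_slope r x *\<^sub>R E x - of_real (poisson_slope r x * (2 * x)) * L) has_integral
        (2 * pi * u r - poisson r pi *\<^sub>R E pi) - of_real (2 * pi - poisson r pi * (2 * pi)) * L) {0..pi}"
      by (intro has_integral_diff u has_integral_mult_left has_integral_of_real poisson_slope_total r)
    then show ?thesis
      by (simp add: scaleR_conv_of_real algebra_simps)
  qed
  show ?thesis
  proof (rule tendstoI)
    fix e :: real assume e: "0 < e"
    have "\<forall>\<^sub>F x in at_right 0. dist (E x /\<^sub>R x) (2 * L) < e"
      by (rule tendstoD[OF lim e])
    then obtain b where b: "0 < b" "\<And>x. 0 < x \<Longrightarrow> x < b \<Longrightarrow> dist (E x /\<^sub>R x) (2 * L) < e"
      unfolding eventually_at_right_field by auto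
    define d where "d = min (b / 2) (pi / 2)"
    have d: "0 < d" "d < b" "d \<le> pi / 2"
      using b by (auto simp: d_def)
    have near: "cmod (E x - of_real (2 * x) * L) \<le> e / 2 * (2 * x)" if "0 < x" "x \<le> d" for x
    proof -
      have "E x - of_real (2 * x) * L = x *\<^sub>R (E x /\<^sub>R x - 2 * L)"
        using that by (simp add: scaleR_conv_of_real algebra_simps)
      then have "cmod (E x - of_real (2 * x) * L) = x * cmod (E x /\<^sub>R x - 2 * L)"
        using that by simp
      also have "\<dots> \<le> x * e"
        using b(2)[of x] that d by (intro mult_left_mono) (auto simp: dist_norm)
      finally show ?thesis by (simp add: mult.commute)
    qed
    define K where "K = M + pi * (2 / (sin d) ^ 4 * M)"
    \<comment> \<open>On \<open>{0..d}\<close> the mass of the kernel is used, on \<open>{d..\<pi>}\<close> its smallness.\<close>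
    have bound: "cmod (2 * pi * (u r - L)) \<le> (1 - r\<^sup>2) * K + e / 2 * (2 * pi)" if r: "0 \<le> r" "r < 1" for r
    proof -
      have r2: "0 \<le> 1 - r\<^sup>2" "r\<^sup>2 < 1" using r by (auto simp: power_le_one power_less_one_iff)
      let ?I = "2 * pi * (u r - L) - poisson r pi *\<^sub>R (E pi - of_real (2 * pi) * L)"
      have sd: "0 < sin d" using d by (intro sin_gt_zero) (use pi_gt_zero in linarith)+
      have "cmod ?I \<le> e / 2 * (2 * pi - poisson r pi * (2 * pi)) + pi * (2 * (1 - r\<^sup>2) / (sin d) ^ 4 * M)"
      proof -
        have maj: "((\<lambda>x. e / 2 * (poisson_slope r x * (2 * x)) + 2 * (1 - r\<^sup>2) / (sin d) ^ 4 * M) has_integral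
            e / 2 * (2 * pi - poisson r pi * (2 * pi)) + (pi - 0) *\<^sub>R (2 * (1 - r\<^sup>2) / (sin d) ^ 4 * M)) {0..pi}"
          using has_integral_const_real[of "2 * (1 - r\<^sup>2) / (sin d) ^ 4 * M" 0 pi]
          by (intro has_integral_add has_integral_mult_right poisson_slope_total r) simp
        have "cmod (integral {0..pi} (\<lambda>x. poisson_slope r x *\<^sub>R (E x - of_real (2 * x) * L)))
            \<le> integral {0..pi} (\<lambda>x. e / 2 * (poisson_slope r x * (2 * x)) + 2 * (1 - r\<^sup>2) / (sin d) ^ 4 * M)"
        proof (rule integral_norm_bound_integral)
          fix x assume x: "x \<in> {0..pi}"
          have nn: "0 \<le> poisson_slope r x" using x r by (intro poisson_slope_nonneg) auto
          have nn1: "0 \<le> e / 2 * (poisson_slope r x * (2 * x))" using e x nn by simp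
          have nn2: "0 \<le> 2 * (1 - r\<^sup>2) / (sin d) ^ 4 * M" using r2 M by simp
          consider "x = 0" | "0 < x" "x \<le> d" | "d \<le> x" using x by force
          then show "cmod (poisson_slope r x *\<^sub>R (E x - of_real (2 * x) * L))
            \<le> e / 2 * (poisson_slope r x * (2 * x)) + 2 * (1 - r\<^sup>2) / (sin d) ^ 4 * M"
          proof cases
            case 1
            then show ?thesis using nn2 by (simp add: poisson_slope_def)
          next
            case 2
            have "cmod (poisson_slope r x *\<^sub>R (E x - of_real (2 * x) * L))
                \<le> poisson_slope r x * (e / 2 * (2 * x))"
              using nn near[OF 2] by (simp add: mult_left_mono)
            also have "\<dots> = e / 2 * (poisson_slope r x * (2 * x))" by simp
            finally show ?thesis using nn2 by linarith
          next
            case 3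
            have "cmod (poisson_slope r x *\<^sub>R (E x - of_real (2 * x) * L))
                = poisson_slope r x * cmod (E x - of_real (2 * x) * L)"
              using nn by simp
            also have "\<dots> \<le> 2 * (1 - r\<^sup>2) / (sin d) ^ 4 * M"
              using x 3 r2 by (intro mult_mono poisson_slope_le r d EM) auto
            finally show ?thesis using nn1 by linarith
          qed
        qed (use diff[OF r] maj in \<open>auto simp: has_integral_iff\<close>)
        then show ?thesis
          using integral_unique[OF diff[OF r]] integral_unique[OF maj] by simp
      qed
      also have "\<dots> \<le> e / 2 * (2 * pi) + (1 - r\<^sup>2) * (pi * (2 / (sin d) ^ 4 * M))"
      proof -
        have "0 \<le> poisson r pi" using r2 r by (simp add: poisson_def)
        then have "e / 2 * (2 * pi - poisson r pi * (2 * pi)) \<le> e / 2 * (2 * pi)"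
          using e by (intro mult_left_mono) auto
        then show ?thesis by (simp add: mult_ac)
      qed
      finally have I: "cmod ?I \<le> e / 2 * (2 * pi) + (1 - r\<^sup>2) * (pi * (2 / (sin d) ^ 4 * M))" .
      have "poisson r pi \<le> 1 - r\<^sup>2"
        unfolding poisson_def using r r2 mult_left_mono[of 1 "1 + 2 * r + r\<^sup>2" "1 - r\<^sup>2"] by (simp add: divide_le_eq)
      moreover have "0 \<le> poisson r pi" using r2 r by (simp add: poisson_def)
      ultimately have J: "cmod (poisson r pi *\<^sub>R (E pi - of_real (2 * pi) * L)) \<le> (1 - r\<^sup>2) * M"
        using EM[of pi] r2 by (simp add: mult_mono)
      have "cmod (2 * pi * (u r - L)) \<le> cmod ?I + cmod (poisson r pi *\<^sub>R (E pi - of_real (2 * pi) * L))"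
        using norm_triangle_ineq[of ?I "poisson r pi *\<^sub>R (E pi - of_real (2 * pi) * L)"] by simp
      with I J show ?thesis by (simp add: K_def algebra_simps)
    qed
    have "((\<lambda>r. (1 - r\<^sup>2) * K) \<longlongrightarrow> (1 - 1\<^sup>2) * K) (at_left (1::real))"
      by (intro tendsto_intros)
    then have "\<forall>\<^sub>F r in at_left (1::real). (1 - r\<^sup>2) * K < e * pi"
      by (rule order_tendstoD) (use e in simp)
    moreover have "\<forall>\<^sub>F r in at_left (1::real). r \<in> {0<..<1}"
      by (rule eventually_at_leftI[of 0]) auto
    ultimately show "\<forall>\<^sub>F r in at_left 1. dist (u r) L < e"
    proof eventually_elim
      case (elim r)
      then have "cmod (2 * pi * (u r - L)) < 2 * pi * e"
      proof -
        have "cmod (2 * pi * (u r - L)) \<le> (1 - r\<^sup>2) * K + e / 2 * (2 * pi)"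
          using elim by (intro bound) auto
        moreover have "e / 2 * (2 * pi) = e * pi" "2 * pi * e = e * pi + e * pi" by simp_all
        ultimately show ?thesis using elim by linarith
      qed
      then show ?case by (simp add: norm_mult dist_norm mult.assoc)
    qed
  qed
qed

section \<open>Radial limits\<close>

context l2_power_series
begin

lemma continuous_dilation: "continuous_on (cball 0 1) (\<lambda>z. phi (rad k *\<^sub>R z))"
proof (rule continuous_on_compose2[OF holomorphic_on_imp_continuous_on[OF holomorphic_phi]])
  have "cmod (rad k *\<^sub>R z) < 1" if "z \<in> cball 0 1" for z
    using that rad(1,2)[of k] mult_left_le[of "cmod z" "rad k"] by simp
  then show "(\<lambda>z. rad k *\<^sub>R z) ` cball 0 1 \<subseteq> ball (0 :: complex) 1"
    by auto
qed (intro continuous_intros)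

lemma continuous_dilation_cis: "continuous_on S (\<lambda>s. phi (rad k *\<^sub>R cis s))"
  by (rule continuous_on_compose2[OF continuous_dilation]) (auto intro!: continuous_intros)

lemma boundary_value_finite_L1: "circle_integral (\<lambda>z. ennreal (cmod (boundary_value z))) < \<infinity>"
proof -
  have "compact ((\<lambda>z. phi (rad 0 *\<^sub>R z)) ` cball 0 1)"
    by (intro compact_continuous_image continuous_dilation compact_cball)
  then obtain C where "\<forall>w\<in>(\<lambda>z. phi (rad 0 *\<^sub>R z)) ` cball 0 1. cmod w \<le> C"
    using compact_imp_bounded bounded_iff by metis
  then have C: "cmod (phi (rad 0 *\<^sub>R z)) \<le> C" if "cmod z \<le> 1" for z
    using that by simp
  have C0: "0 \<le> C" using C[of 0] by (auto intro: order.trans[OF norm_ge_zero])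
  have "circle_integral (\<lambda>z. ennreal (cmod (boundary_value z)))
      \<le> circle_integral (\<lambda>z. ennreal (cmod (phi (rad 0 *\<^sub>R z) - boundary_value z)) + ennreal C)"
  proof (rule circle_integral_mono)
    fix z :: complex assume "cmod z = 1"
    then have "cmod (boundary_value z) \<le> cmod (phi (rad 0 *\<^sub>R z) - boundary_value z) + C"
      using C[of z] norm_triangle_sub[of "boundary_value z" "phi (rad 0 *\<^sub>R z)"] by (simp add: norm_minus_commute)
    then show "ennreal (cmod (boundary_value z)) \<le> ennreal (cmod (phi (rad 0 *\<^sub>R z) - boundary_value z)) + ennreal C"
      using C0 by (simp add: ennreal_plus[symmetric] ennreal_leI del: ennreal_plus)
  qed
  also have "\<dots> \<le> ennreal (5 * pi * (1 / 2) ^ 0) + ennreal (2 * pi) * ennreal C"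
    unfolding circle_integral_const[symmetric]
    by (subst circle_integral_add) (simp_all add: boundary_value_L1[of 0, simplified] add_right_mono)
  also have "\<dots> < \<infinity>"
    by (simp add: ennreal_mult_less_top)
  finally show ?thesis .
qed

lemma set_integrable_boundary_value: "set_integrable lborel {p..q} (\<lambda>t. boundary_value (cis t))"
proof -
  have period: "set_integrable lborel {c..c + 2 * pi} (\<lambda>t. boundary_value (cis t))" for c
    unfolding set_integrable_def
  proof (rule integrableI_bounded)
    have "(\<integral>\<^sup>+ t. ennreal (norm (indicator {c..c + 2 * pi} t *\<^sub>R boundary_value (cis t))) \<partial>lborel)
        = (\<integral>\<^sup>+ t. ennreal (cmod (boundary_value (cis t))) * indicator {c..c + 2 * pi} t \<partial>lborel)"
      by (intro nn_integral_cong) (simp split: split_indicator)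
    also have "\<dots> = circle_integral (\<lambda>z. ennreal (cmod (boundary_value z)))"
      by (rule circle_integral_shift) simp
    finally show "(\<integral>\<^sup>+ t. ennreal (norm (indicator {c..c + 2 * pi} t *\<^sub>R boundary_value (cis t))) \<partial>lborel) < \<infinity>"
      using boundary_value_finite_L1 by simp
  qed simp
  have multi: "set_integrable lborel {p..p + 2 * pi * real n} (\<lambda>t. boundary_value (cis t))" for n
  proof (induction n)
    case 0
    show ?case by (rule set_integrable_subset[OF period[of p]]) auto
  next
    case (Suc n)
    have "{p..p + 2 * pi * real n} \<union> {p + 2 * pi * real n..p + 2 * pi * real n + 2 * pi} = {p..p + 2 * pi * real (Suc n)}"
      by (subst ivl_disj_un_two_touch) (simp_all add: algebra_simps)
    then show ?case
      using set_integrable_Un[OF Suc period[of "p + 2 * pi * real n"]] by simp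
  qed
  obtain n where "(q - p) / (2 * pi) \<le> real n"
    using real_arch_simple by blast
  then have "{p..q} \<subseteq> {p..p + 2 * pi * real n}"
    by (auto simp: field_simps)
  then show ?thesis
    by (intro set_integrable_subset[OF multi[of n]]) auto
qed

lemma boundary_value_integrable_on: "(\<lambda>t. boundary_value (cis t)) integrable_on {p..q}"
  using set_borel_integral_eq_integral(1)[OF set_integrable_boundary_value] .

lemma window_L1:
  assumes x: "0 \<le> x" "x \<le> pi"
  shows "cmod (integral {t - x..t + x} (\<lambda>s. phi (rad k *\<^sub>R cis s)) - integral {t - x..t + x} (\<lambda>s. boundary_value (cis s)))
    \<le> 5 * pi * (1 / 2) ^ k"
proof -
  let ?f = "\<lambda>s. phi (rad k *\<^sub>R cis s)" and ?g = "\<lambda>s. boundary_value (cis s)" and ?A = "{t - x..t + x}"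
  have f: "set_integrable lborel ?A ?f"
    by (intro borel_integrable_atLeastAtMost' continuous_dilation_cis)
  have fg: "set_integrable lborel ?A (\<lambda>s. ?f s - ?g s)"
    by (intro set_integral_diff f set_integrable_boundary_value)
  have "integral ?A ?f - integral ?A ?g = (LINT s:?A|lborel. ?f s - ?g s)"
    using f set_integrable_boundary_value[of "t - x" "t + x"]
    by (simp add: set_integral_diff set_borel_integral_eq_integral)
  then have "ennreal (cmod (integral ?A ?f - integral ?A ?g))
      \<le> (\<integral>\<^sup>+ s. ennreal (norm (indicator ?A s *\<^sub>R (?f s - ?g s))) \<partial>lborel)"
    using fg unfolding set_integrable_def set_lebesgue_integral_def by (simp only: integral_norm_bound_ennreal)
  also have "\<dots> \<le> (\<integral>\<^sup>+ s. ennreal (cmod (?f s - ?g s)) * indicator {t - pi..t - pi + 2 * pi} s \<partial>lborel)"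
    using x by (intro nn_integral_mono) (auto split: split_indicator)
  also have "\<dots> = circle_integral (\<lambda>z. ennreal (cmod (phi (rad k *\<^sub>R z) - boundary_value z)))"
    by (rule circle_integral_shift) simp
  also have "\<dots> \<le> ennreal (5 * pi * (1 / 2) ^ k)"
    by (rule boundary_value_L1)
  finally show ?thesis by simp
qed

lemma window_bounded:
  "\<exists>C. \<forall>x\<in>{0..pi}. cmod (integral {t - x..t + x} (\<lambda>s. boundary_value (cis s))) \<le> C"
proof -
  have "cmod (integral {t - x..t + x} (\<lambda>s. boundary_value (cis s))) \<le> (LINT s:{t - pi..t + pi}|lborel. cmod (boundary_value (cis s)))"
    if x: "x \<in> {0..pi}" for x
  proof -
    have "integral {t - x..t + x} (\<lambda>s. boundary_value (cis s)) = (LINT s:{t - x..t + x}|lborel. boundary_value (cis s))"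
      by (rule set_borel_integral_eq_integral(2)[OF set_integrable_boundary_value, symmetric])
    also have "cmod \<dots> \<le> (LINT s:{t - x..t + x}|lborel. cmod (boundary_value (cis s)))"
      by (intro set_integral_norm_bound set_integrable_boundary_value)
    also have "\<dots> \<le> (LINT s:{t - pi..t + pi}|lborel. cmod (boundary_value (cis s)))"
      unfolding set_lebesgue_integral_def
    proof (rule integral_mono)
      show "indicator {t - x..t + x} s *\<^sub>R cmod (boundary_value (cis s)) \<le> indicator {t - pi..t + pi} s *\<^sub>R cmod (boundary_value (cis s))" for s
        using x by (auto split: split_indicator)
    qed (use set_integrable_norm[OF set_integrable_boundary_value] in \<open>auto simp: set_integrable_def\<close>)
    finally show ?thesis .
  qed
  then show ?thesis by blast
qed

lemma poisson_boundary_value: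
  assumes r: "0 \<le> r" "r < 1"
  shows "((\<lambda>x. poisson_slope r x *\<^sub>R integral {t - x..t + x} (\<lambda>s. boundary_value (cis s))) has_integral
    2 * pi * phi (r *\<^sub>R cis t) - poisson r pi *\<^sub>R integral {t - pi..t + pi} (\<lambda>s. boundary_value (cis s))) {0..pi}"
proof -
  define E where "E x = integral {t - x..t + x} (\<lambda>s. boundary_value (cis s))" for x
  define e where "e k x = integral {t - x..t + x} (\<lambda>s. phi (rad k *\<^sub>R cis s))" for k x
  obtain C where C: "\<And>x. x \<in> {0..pi} \<Longrightarrow> cmod (E x) \<le> C"
    using window_bounded unfolding E_def by blast
  have ek: "((\<lambda>x. poisson_slope r x *\<^sub>R e k x) has_integral
      2 * pi * phi (rad k *\<^sub>R (r *\<^sub>R cis t)) - poisson r pi *\<^sub>R e k pi) {0..pi}" for k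
  proof -
    \<comment> \<open>The dilation is holomorphic past the circle; rotating by \<open>t\<close> moves the point to the real axis.\<close>
    define F where "F w = phi (of_real (rad k) * cis t * w)" for w
    have "cmod (of_real (rad k) * cis t * w) < 1" if "w \<in> cball 0 1" for w
      using that rad(1,2)[of k] mult_left_le[of "cmod w" "rad k"] by (simp add: norm_mult)
    then have "F holomorphic_on cball 0 1"
      unfolding F_def
      by (intro holomorphic_on_compose_gen[OF _ holomorphic_phi, unfolded o_def] holomorphic_intros) auto
    moreover have "integral {- x..x} (\<lambda>s. F (cis s)) = e k x" for x
      using integral_shift_Icc_real[of "- x" x "\<lambda>s. phi (rad k *\<^sub>R cis s)" t]
      by (simp add: F_def e_def o_def cis_mult scaleR_conv_of_real mult.assoc add.commute)
    ultimately show ?thesis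
      using poisson_formula_by_parts[of F r] r
      by (simp add: F_def scaleR_conv_of_real mult_ac)
  qed
  have conv: "(\<lambda>k. e k x) \<longlonglongrightarrow> E x" if "x \<in> {0..pi}" for x
  proof (rule LIM_zero_cancel, rule Lim_null_comparison)
    show "\<forall>\<^sub>F k in sequentially. cmod (e k x - E x) \<le> 5 * pi * (1 / 2) ^ k"
      unfolding e_def E_def using that by (intro always_eventually allI window_L1) auto
    show "(\<lambda>k. 5 * pi * (1 / 2) ^ k) \<longlonglongrightarrow> 0"
      by (intro tendsto_mult_right_zero LIMSEQ_power_zero) simp
  qed
  have bound: "cmod (e k x) \<le> C + 5 * pi" if "x \<in> {0..pi}" for k x
  proof -
    have "cmod (e k x) \<le> cmod (E x) + cmod (e k x - E x)"
      using norm_triangle_sub[of "e k x" "E x"] by (simp add: add.commute)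
    also have "cmod (e k x - E x) \<le> 5 * pi * (1 / 2) ^ k"
      unfolding e_def E_def using that by (intro window_L1) auto
    also have "\<dots> \<le> 5 * pi * 1"
      by (intro mult_left_mono power_le_one) auto
    finally show ?thesis using C[OF that] by simp
  qed
  have "(\<lambda>x. poisson_slope r x *\<^sub>R e k x) integrable_on {0..pi}" for k
    using ek by blast
  moreover have "(\<lambda>x. poisson_slope r x * (C + 5 * pi)) integrable_on {0..pi}"
    by (intro integrable_continuous_real continuous_intros continuous_poisson_slope r)
  moreover have "cmod (poisson_slope r x *\<^sub>R e k x) \<le> poisson_slope r x * (C + 5 * pi)" if "x \<in> {0..pi}" for k x
    using bound[OF that, of k] poisson_slope_nonneg[OF r, of x] that by (simp add: mult_left_mono)
  moreover have "(\<lambda>k. poisson_slope r x *\<^sub>R e k x) \<longlonglongrightarrow> poisson_slope r x *\<^sub>R E x" if "x \<in> {0..pi}" for x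
    by (intro tendsto_intros conv that)
  ultimately have lim: "(\<lambda>x. poisson_slope r x *\<^sub>R E x) integrable_on {0..pi}"
    "(\<lambda>k. integral {0..pi} (\<lambda>x. poisson_slope r x *\<^sub>R e k x)) \<longlonglongrightarrow> integral {0..pi} (\<lambda>x. poisson_slope r x *\<^sub>R E x)"
    by (rule dominated_convergence; blast)+
  have "isCont phi (r *\<^sub>R cis t)"
    using holomorphic_on_imp_continuous_on[OF holomorphic_phi] r
    by (simp add: continuous_on_eq_continuous_at)
  then have "(\<lambda>k. phi (rad k *\<^sub>R (r *\<^sub>R cis t))) \<longlonglongrightarrow> phi (r *\<^sub>R cis t)"
    by (rule isCont_tendsto_compose) (use tendsto_scaleR[OF tendsto_rad tendsto_const, of "r *\<^sub>R cis t"] in simp)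
  then have "(\<lambda>k. 2 * pi * phi (rad k *\<^sub>R (r *\<^sub>R cis t)) - poisson r pi *\<^sub>R e k pi)
      \<longlonglongrightarrow> 2 * pi * phi (r *\<^sub>R cis t) - poisson r pi *\<^sub>R E pi"
    by (intro tendsto_intros conv) auto
  moreover have "2 * pi * phi (rad k *\<^sub>R (r *\<^sub>R cis t)) - poisson r pi *\<^sub>R e k pi
      = integral {0..pi} (\<lambda>x. poisson_slope r x *\<^sub>R e k x)" for k
    using integral_unique[OF ek] by simp
  ultimately have "integral {0..pi} (\<lambda>x. poisson_slope r x *\<^sub>R E x) = 2 * pi * phi (r *\<^sub>R cis t) - poisson r pi *\<^sub>R E pi"
    using LIMSEQ_unique[OF lim(2)] by simp
  then show ?thesis
    using lim(1) by (simp add: has_integral_iff E_def)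
qed

end

text \<open>Lebesgue differentiation from the right, applied to \<open>B\<close> and to its reflection.\<close>

lemma AE_symmetric_derivative:
  fixes B :: "real \<Rightarrow> complex"
  assumes B: "\<And>a b. B integrable_on {a..b}"
  shows "AE t in lborel. ((\<lambda>x. integral {t - x..t + x} B /\<^sub>R x) \<longlongrightarrow> 2 * B t) (at_right 0)"
proof -
  have neg: "AE t in lborel. t \<notin> N" if "negligible N" for N :: "real set"
    using that AE_not_in[of N lebesgue] unfolding negligible_iff_null_sets by (simp add: AE_completion_iff)
  have B': "(\<lambda>s. B (- s)) integrable_on {a..b}" for a b
    using Henstock_Kurzweil_Integration.integrable_reflect_real[of B "- a" "- b"] B[of "- b" "- a"] by simp
  obtain N1 where N1: "negligible N1" "\<And>x e. \<lbrakk>x \<notin> N1; 0 < e\<rbrakk> \<Longrightarrow>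
     \<exists>d>0. \<forall>h. 0 < h \<and> h < d \<longrightarrow> norm (integral (cbox x (x + h *\<^sub>R One)) B /\<^sub>R h ^ DIM(real) - B x) < e"
    using integrable_ccontinuous_explicit[of B] B by (metis cbox_interval)
  obtain N2 where N2: "negligible N2" "\<And>x e. \<lbrakk>x \<notin> N2; 0 < e\<rbrakk> \<Longrightarrow>
     \<exists>d>0. \<forall>h. 0 < h \<and> h < d \<longrightarrow> norm (integral (cbox x (x + h *\<^sub>R One)) (\<lambda>s. B (- s)) /\<^sub>R h ^ DIM(real) - B (- x)) < e"
    using integrable_ccontinuous_explicit[of "\<lambda>s. B (- s)"] B' by (metis cbox_interval)
  have "AE t in distr lborel borel uminus. t \<notin> N2"
    unfolding lborel_distr_uminus by (rule neg[OF N2(1)])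
  then have "AE t in lborel. - t \<notin> N2"
    by (rule AE_distrD[rotated]) simp
  from this neg[OF N1(1)] show ?thesis
  proof eventually_elim
    case (elim t)
    have right: "((\<lambda>x. integral {t..t + x} B /\<^sub>R x) \<longlongrightarrow> B t) (at_right 0)"
    proof (rule tendstoI)
      fix e :: real assume "0 < e"
      from N1(2)[OF elim(2) this] show "\<forall>\<^sub>F x in at_right 0. dist (integral {t..t + x} B /\<^sub>R x) (B t) < e"
        unfolding eventually_at_right_field by (auto simp: dist_norm)
    qed
    have left: "((\<lambda>x. integral {t - x..t} B /\<^sub>R x) \<longlongrightarrow> B t) (at_right 0)"
    proof (rule tendstoI)
      fix e :: real assume "0 < e"
      have "integral {- t..- t + x} (\<lambda>s. B (- s)) = integral {t - x..t} B" for x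
        using Henstock_Kurzweil_Integration.integral_reflect_real[of t "t - x" B] by simp
      with N2(2)[OF elim(1) \<open>0 < e\<close>] show "\<forall>\<^sub>F x in at_right 0. dist (integral {t - x..t} B /\<^sub>R x) (B t) < e"
        unfolding eventually_at_right_field by (auto simp: dist_norm)
    qed
    have "((\<lambda>x. integral {t - x..t} B /\<^sub>R x + integral {t..t + x} B /\<^sub>R x) \<longlongrightarrow> B t + B t) (at_right 0)"
      by (intro tendsto_add left right)
    then have "((\<lambda>x. integral {t - x..t} B /\<^sub>R x + integral {t..t + x} B /\<^sub>R x) \<longlongrightarrow> 2 * B t) (at_right 0)"
      by (simp only: mult_2)
    moreover have "\<forall>\<^sub>F x in at_right 0. integral {t - x..t} B /\<^sub>R x + integral {t..t + x} B /\<^sub>R x = integral {t - x..t + x} B /\<^sub>R x"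
      using eventually_at_right_less[of 0]
    proof eventually_elim
      case (elim x)
      then have "integral {t - x..t} B + integral {t..t + x} B = integral {t - x..t + x} B"
        by (intro Henstock_Kurzweil_Integration.integral_combine B) auto
      then show ?case by (simp add: scaleR_add_right[symmetric])
    qed
    ultimately show ?case
      by (rule Lim_transform_eventually)
  qed
qed

context l2_power_series
begin

text \<open>Fatou's theorem for square summable power series.\<close>

theorem AE_radial_limit: "AE t in lborel. ((\<lambda>r. phi (r *\<^sub>R cis t)) \<longlongrightarrow> boundary_value (cis t)) (at_left 1)"
  using AE_symmetric_derivative[OF boundary_value_integrable_on]
proof eventually_elim
  case (elim t)
  obtain C where C: "\<And>x. x \<in> {0..pi} \<Longrightarrow> cmod (integral {t - x..t + x} (\<lambda>s. boundary_value (cis s))) \<le> C"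
    using window_bounded by blast
  show ?case
    by (rule poisson_means_tendsto[OF poisson_boundary_value C elim])
qed

end

section \<open>Jensen's inequality\<close>

lemma circle_cnj: "cmod z = 1 \<Longrightarrow> cnj z * z = 1" 
  using complex_norm_square[of z] by (simp add: mult.commute)

text \<open>Functions that agree on the unit circle with the real part of a complex polynomial. They form
  an algebra, because \<open>cnj z = 1 / z\<close> there.\<close>

definition re_poly :: "(complex \<Rightarrow> real) \<Rightarrow> bool"
  where "re_poly f \<longleftrightarrow> (\<exists>p. \<forall>z\<in>sphere 0 1. f z = Re (poly p z))"

lemma re_poly_add:
  assumes "re_poly f" "re_poly g"
  shows "re_poly (\<lambda>z. f z + g z)"
proof -
  obtain p q where "\<forall>z\<in>sphere 0 1. f z = Re (poly p z)" "\<forall>z\<in>sphere 0 1. g z = Re (poly q z)"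
    using assms unfolding re_poly_def by blast
  then show ?thesis
    unfolding re_poly_def by (intro exI[of _ "p + q"]) auto
qed

text \<open>Negative powers of \<open>z\<close> on the circle are turned into positive ones by conjugation
  under the real part.\<close>

lemma re_poly_cnj_monom: "\<exists>r. \<forall>z\<in>sphere 0 1. Re (cnj z ^ n * poly p z) = Re (poly r z)"
proof (induction p arbitrary: n)
  case 0
  show ?case by (intro exI[of _ 0]) simp
next
  case (pCons a p)
  show ?case
  proof (cases n)
    case 0
    then show ?thesis by (intro exI[of _ "pCons a p"]) simp
  next
    case (Suc m)
    obtain r where r: "\<forall>z\<in>sphere 0 1. Re (cnj z ^ m * poly p z) = Re (poly r z)"
      using pCons.IH by blast
    have "Re (cnj z ^ n * poly (pCons a p) z) = Re (poly (monom (cnj a) n + r) z)" if z: "z \<in> sphere 0 1" for z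
    proof -
      \<comment> \<open>The constant term is conjugated, and one factor \<open>cnj z\<close> cancels against the \<open>z\<close> in front of \<open>p\<close>.\<close>
      have 1: "cnj z ^ n * poly (pCons a p) z = cnj (poly (monom (cnj a) n) z) + cnj z ^ m * (cnj z * z) * poly p z"
        by (simp add: Suc poly_monom algebra_simps)
      have "cnj z * z = 1" using z by (intro circle_cnj) simp
      then show ?thesis unfolding 1 using r z by simp
    qed
    then show ?thesis by blast
  qed
qed

lemma re_poly_mult_cnj: "\<exists>r. \<forall>z\<in>sphere 0 1. Re (cnj (poly q z) * cnj z ^ n * poly p z) = Re (poly r z)"
proof (induction q arbitrary: n)
  case 0
  show ?case by (intro exI[of _ 0]) simp
next
  case (pCons a q)
  obtain r where r: "\<forall>z\<in>sphere 0 1. Re (cnj (poly q z) * cnj z ^ Suc n * poly p z) = Re (poly r z)"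
    using pCons.IH by blast
  obtain s where s: "\<forall>z\<in>sphere 0 1. Re (cnj z ^ n * poly (smult (cnj a) p) z) = Re (poly s z)"
    using re_poly_cnj_monom by blast
  have "Re (cnj (poly (pCons a q) z) * cnj z ^ n * poly p z) = Re (poly (s + r) z)" if z: "z \<in> sphere 0 1" for z
  proof -
    have "cnj (poly (pCons a q) z) * cnj z ^ n * poly p z =
        cnj z ^ n * poly (smult (cnj a) p) z + cnj (poly q z) * cnj z ^ Suc n * poly p z"
      by (simp add: algebra_simps)
    then show ?thesis using r s z by (simp only: plus_complex.sel poly_add)
  qed
  then show ?case by blast
qed

lemma re_poly_mult:
  assumes "re_poly f" "re_poly g"
  shows "re_poly (\<lambda>z. f z * g z)"
proof -
  obtain p q where pq: "\<forall>z\<in>sphere 0 1. f z = Re (poly p z)" "\<forall>z\<in>sphere 0 1. g z = Re (poly q z)"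
    using assms unfolding re_poly_def by blast
  obtain r where r: "\<forall>z\<in>sphere 0 1. Re (cnj (poly q z) * cnj z ^ 0 * poly p z) = Re (poly r z)"
    using re_poly_mult_cnj by blast
  have "f z * g z = Re (poly (smult (1/2) (p * q + r)) z)" if z: "z \<in> sphere 0 1" for z
  proof -
    have "Re (poly r z) = Re (cnj (poly q z) * poly p z)" using r z by simp
    then show ?thesis using pq z by (simp add: field_simps)
  qed
  then show ?thesis unfolding re_poly_def by blast
qed

lemma re_poly_dense:
  fixes u :: "complex \<Rightarrow> real"
  assumes "continuous_on (sphere 0 1) u" "0 < e"
  obtains p where "\<And>z. cmod z = 1 \<Longrightarrow> \<bar>u z - Re (poly p z)\<bar> < e"
proof -
  let ?P = "\<lambda>f. re_poly f \<and> continuous_on (sphere 0 1) f"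
  have "\<exists>g. ?P g \<and> (\<forall>z\<in>sphere 0 1. \<bar>u z - g z\<bar> < e)"
  proof (rule Stone_Weierstrass_HOL[OF compact_sphere])
    show "?P (\<lambda>x. c)" for c
      unfolding re_poly_def by (auto intro!: exI[of _ "[:of_real c:]"])
    show "\<exists>f. ?P f \<and> f x \<noteq> f y" if "x \<in> sphere 0 1 \<and> y \<in> sphere 0 1 \<and> x \<noteq> y" for x y
    proof -
      have "re_poly Re" "re_poly Im"
        unfolding re_poly_def by (rule exI[of _ "[:0, 1:]"], simp) (rule exI[of _ "[:0, - \<i>:]"], simp)
      then have "?P Re" "?P Im"
        by (simp_all add: continuous_intros)
      moreover have "Re x \<noteq> Re y \<or> Im x \<noteq> Im y" using that by (auto simp: complex_eq_iff)
      ultimately show ?thesis by blast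
    qed
  qed (use assms in \<open>auto intro: re_poly_add re_poly_mult continuous_intros\<close>)
  then show ?thesis
    unfolding re_poly_def by (metis that mem_sphere_0)
qed

lemma has_integral_poly_circle:
  "((\<lambda>t. Re (poly p (cis t))) has_integral 2 * pi * Re (poly p 0)) {0..2 * pi}"
proof -
  have "((\<lambda>u. poly p u / (u - 0)) has_contour_integral 2 * of_real pi * \<i> * poly p 0) (circlepath 0 1)"
    by (rule Cauchy_integral_circlepath_simple) (auto intro!: holomorphic_intros)
  then have "((\<lambda>t. poly p (cis t) / cis t * \<i> * cis t) has_integral 2 * of_real pi * \<i> * poly p 0) {0..2 * pi}"
    unfolding circlepath_def by (subst (asm) has_contour_integral_part_circlepath_iff) simp_all
  from has_integral_linear[OF this bounded_linear_Im] show ?thesis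
    by (simp add: o_def mult.assoc)
qed

text \<open>Jensen's inequality without counting zeros: \<open>u\<close> is approximated uniformly on the
  circle by the real part of a polynomial \<open>p\<close>, and the maximum modulus principle is
  applied to \<open>\<psi> exp(- p)\<close>.\<close>

lemma jensen_inequality_majorant:
  fixes \<psi> :: "complex \<Rightarrow> complex" and u :: "complex \<Rightarrow> real"
  assumes hol: "\<psi> holomorphic_on ball 0 1" and cont: "continuous_on (cball 0 1) \<psi>"
    and u: "continuous_on (sphere 0 1) u"
    and maj: "\<And>z. cmod z = 1 \<Longrightarrow> cmod (\<psi> z) \<le> exp (u z)"
  shows "cmod (\<psi> 0) \<le> exp (integral {0..2 * pi} (\<lambda>t. u (cis t)) / (2 * pi))"
proof -
  let ?m = "integral {0..2 * pi} (\<lambda>t. u (cis t)) / (2 * pi)"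
  have uint: "(\<lambda>t. u (cis t)) integrable_on {0..2 * pi}"
    by (intro integrable_continuous_real continuous_on_compose2[OF u] continuous_intros) auto
  have "cmod (\<psi> 0) \<le> exp (?m + 2 * e)" if e: "0 < e" for e
  proof -
    obtain p where p: "\<And>z. cmod z = 1 \<Longrightarrow> \<bar>u z - Re (poly p z)\<bar> < e"
      using re_poly_dense[OF u e] by blast
    have "cmod (\<psi> 0 * exp (- poly p 0)) \<le> exp e"
    proof (rule maximum_modulus_frontier[where S = "cball 0 1" and f = "\<lambda>z. \<psi> z * exp (- poly p z)"])
      show "(\<lambda>z. \<psi> z * exp (- poly p z)) holomorphic_on interior (cball 0 1)"
        using hol by (auto intro!: holomorphic_intros)
      show "continuous_on (closure (cball 0 1)) (\<lambda>z. \<psi> z * exp (- poly p z))"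
        using cont by (auto intro!: continuous_intros)
      fix z :: complex assume "z \<in> frontier (cball 0 1)"
      then have z: "cmod z = 1" by simp
      have "cmod (\<psi> z * exp (- poly p z)) = cmod (\<psi> z) * exp (- Re (poly p z))"
        by (simp add: norm_mult)
      also have "\<dots> \<le> exp (u z) * exp (- Re (poly p z))"
        using maj[OF z] by (intro mult_right_mono) auto
      also have "\<dots> = exp (u z - Re (poly p z))" by (simp add: exp_diff exp_minus divide_inverse)
      also have "\<dots> \<le> exp e" using p[OF z] by simp
      finally show "cmod (\<psi> z * exp (- poly p z)) \<le> exp e" .
    qed auto
    then have "cmod (\<psi> 0) * exp (- Re (poly p 0)) \<le> exp e"
      by (simp add: norm_mult)
    then have 1: "cmod (\<psi> 0) \<le> exp (e + Re (poly p 0))"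
      by (simp add: exp_add exp_minus field_simps)
    have "2 * pi * Re (poly p 0) = integral {0..2 * pi} (\<lambda>t. Re (poly p (cis t)))"
      by (rule integral_unique[OF has_integral_poly_circle, symmetric])
    also have "\<dots> \<le> integral {0..2 * pi} (\<lambda>t. u (cis t) + e)"
    proof (rule integral_le)
      show "(\<lambda>t. Re (poly p (cis t))) integrable_on {0..2 * pi}"
        using has_integral_poly_circle by blast
      show "(\<lambda>t. u (cis t) + e) integrable_on {0..2 * pi}"
        by (intro integrable_add uint integrable_const_ivl)
      show "Re (poly p (cis t)) \<le> u (cis t) + e" for t
        using p[of "cis t"] by simp
    qed
    also have "\<dots> = 2 * pi * (?m + e)"
      by (subst Henstock_Kurzweil_Integration.integral_add[OF uint integrable_const_ivl]) (simp add: field_simps)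
    finally have "Re (poly p 0) \<le> ?m + e" by simp
    then show ?thesis
      using 1 by (elim order.trans) simp
  qed
  moreover have "((\<lambda>e. exp (?m + 2 * e)) \<longlongrightarrow> exp (?m + 2 * 0)) (at_right 0)"
    by (intro tendsto_intros)
  ultimately show ?thesis
    using tendsto_lowerbound[of "\<lambda>e. exp (?m + 2 * e)" "exp ?m" "at_right 0" "cmod (\<psi> 0)"]
    by (simp add: eventually_at_right_less eventually_mono[OF eventually_at_right_less[of 0]])
qed

section \<open>Moebius transformations of the disc\<close>

text \<open>The involution of the unit disc exchanging 0 and \<open>w\<close>.\<close>

definition disc_moebius :: "complex \<Rightarrow> complex \<Rightarrow> complex"
  where "disc_moebius w z = (w - z) / (1 - z * cnj w)"

lemma moebius_denominator_nonzero:
  assumes "cmod w < 1" "cmod z \<le> 1"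
  shows "1 - z * cnj w \<noteq> 0"
proof
  assume "1 - z * cnj w = 0"
  then have "cmod (z * cnj w) = 1" by (metis eq_iff_diff_eq_0 norm_one)
  moreover have "cmod z * cmod w \<le> 1 * cmod w"
    using assms by (intro mult_right_mono) auto
  ultimately show False using assms by (simp add: norm_mult)
qed

lemma disc_moebius_zero [simp]: "disc_moebius w 0 = w"
  by (simp add: disc_moebius_def)

lemma holomorphic_disc_moebius:
  assumes "cmod w < 1"
  shows "disc_moebius w holomorphic_on cball 0 1"
  unfolding disc_moebius_def[abs_def]
  by (intro holomorphic_intros) (use moebius_denominator_nonzero[OF assms] in auto)

lemma measurable_disc_moebius [measurable]: "disc_moebius w \<in> borel_measurable borel"
  unfolding disc_moebius_def[abs_def] by measurable

lemma cmod_disc_moebius_le: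
  assumes w: "cmod w < 1" and z: "cmod z \<le> 1"
  shows "cmod (disc_moebius w z) \<le> 1"
proof -
  have "complex_of_real ((cmod (1 - z * cnj w))\<^sup>2 - (cmod (w - z))\<^sup>2) = of_real ((1 - (cmod w)\<^sup>2) * (1 - (cmod z)\<^sup>2))"
    unfolding of_real_diff of_real_mult of_real_1 complex_norm_square
    by (simp add: algebra_simps)
  then have "(cmod (1 - z * cnj w))\<^sup>2 - (cmod (w - z))\<^sup>2 = (1 - (cmod w)\<^sup>2) * (1 - (cmod z)\<^sup>2)"
    by (simp only: of_real_eq_iff)
  also have "\<dots> \<ge> 0"
    using w z by (intro mult_nonneg_nonneg) (simp_all add: power_le_one)
  finally have "cmod (w - z) \<le> cmod (1 - z * cnj w)"
    by (intro power2_le_imp_le[OF _ norm_ge_zero]) linarith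
  then show ?thesis
    by (simp add: disc_moebius_def norm_divide divide_le_eq_1)
qed

text \<open>A smooth increasing lift to angles of the circle map \<open>disc_moebius w\<close>. On the
  circle this map is \<open>- z \<cdot> cnj v / v\<close> with \<open>v = 1 - z cnj w\<close> in
  the right half plane, where the principal logarithm is smooth.\<close>

definition moebius_angle :: "complex \<Rightarrow> real \<Rightarrow> real"
  where "moebius_angle w t = pi + t - 2 * Im (Ln (1 - cis t * cnj w))"

lemma cis_moebius_angle:
  assumes w: "cmod w < 1"
  shows "cis (moebius_angle w t) = disc_moebius w (cis t)"
proof -
  define v where "v = 1 - cis t * cnj w"
  have v: "v \<noteq> 0"
    unfolding v_def using w by (intro moebius_denominator_nonzero) auto
  have "cnj (Ln v) - Ln v = \<i> * of_real (- 2 * Im (Ln v))"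
    by (simp add: complex_eq_iff)
  then have "cis (- 2 * Im (Ln v)) = exp (cnj (Ln v) - Ln v)"
    by (simp only: cis_conv_exp)
  also have "\<dots> = cnj v / v"
    using v by (simp add: exp_diff exp_cnj[symmetric])
  finally have "cis (- 2 * Im (Ln v)) = cnj v / v" .
  moreover have "cis (moebius_angle w t) = cis pi * cis t * cis (- 2 * Im (Ln v))"
    unfolding cis_mult by (simp add: moebius_angle_def v_def)
  ultimately have "cis (moebius_angle w t) = - cis t * (cnj v / v)"
    by simp
  also have "- cis t * (cnj v / v) = (w * (cis t * cnj (cis t)) - cis t) / v"
    by (simp add: v_def algebra_simps)
  also have "cis t * cnj (cis t) = 1"
    by (simp add: cis_cnj cis_mult)
  finally show ?thesis
    by (simp add: disc_moebius_def v_def)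
qed

lemma moebius_angle_deriv:
  assumes w: "cmod w < 1"
  shows "(moebius_angle w has_real_derivative (1 - (cmod w)\<^sup>2) / (cmod (1 - cis t * cnj w))\<^sup>2) (at t)"
proof -
  define \<zeta> where "\<zeta> = cis t * cnj w"
  have n\<zeta>: "cmod \<zeta> = cmod w" by (simp add: \<zeta>_def norm_mult)
  have nz: "1 - \<zeta> \<noteq> 0"
    unfolding \<zeta>_def using w by (intro moebius_denominator_nonzero) auto
  have "Re \<zeta> < 1" using complex_Re_le_cmod[of \<zeta>] n\<zeta> w by linarith
  then have pos: "1 - \<zeta> \<notin> \<real>\<^sub>\<le>\<^sub>0"
    by (auto simp: complex_nonpos_Reals_iff)
  have "((\<lambda>z. Ln (1 - exp (\<i> * z) * cnj w)) has_field_derivative - (\<i> * \<zeta>) / (1 - \<zeta>)) (at (of_real t))"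
    using pos by (auto intro!: derivative_eq_intros simp: \<zeta>_def cis_conv_exp[symmetric] divide_inverse mult_ac)
  from has_vector_derivative_real_field[OF this]
  have "((\<lambda>t. Ln (1 - cis t * cnj w)) has_vector_derivative - (\<i> * \<zeta>) / (1 - \<zeta>)) (at t)"
    by (simp add: cis_conv_exp)
  from bounded_linear.has_vector_derivative[OF bounded_linear_Im this]
  have "((\<lambda>t. Im (Ln (1 - cis t * cnj w))) has_real_derivative Im (- (\<i> * \<zeta>) / (1 - \<zeta>))) (at t)"
    by (simp add: has_real_derivative_iff_has_vector_derivative)
  then have "(moebius_angle w has_real_derivative 0 + 1 - 2 * Im (- (\<i> * \<zeta>) / (1 - \<zeta>))) (at t)"
    unfolding moebius_angle_def[abs_def]
    by (intro DERIV_diff DERIV_add DERIV_const DERIV_ident DERIV_cmult)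
  also have "0 + 1 - 2 * Im (- (\<i> * \<zeta>) / (1 - \<zeta>)) = (1 - (cmod \<zeta>)\<^sup>2) / (cmod (1 - \<zeta>))\<^sup>2"
  proof -
    have c: "(cmod (1 - \<zeta>))\<^sup>2 \<noteq> 0" using nz by simp
    have "- (\<i> * \<zeta>) / (1 - \<zeta>) = - (\<i> * \<zeta>) * cnj (1 - \<zeta>) / of_real ((cmod (1 - \<zeta>))\<^sup>2)"
      using nz by (simp add: complex_norm_square del: of_real_power)
    then have "Im (- (\<i> * \<zeta>) / (1 - \<zeta>)) = Im (- (\<i> * \<zeta>) * cnj (1 - \<zeta>)) / (cmod (1 - \<zeta>))\<^sup>2"
      by (simp only: Im_divide_of_real)
    moreover have "(cmod (1 - \<zeta>))\<^sup>2 - 2 * Im (- (\<i> * \<zeta>) * cnj (1 - \<zeta>)) = 1 - (cmod \<zeta>)\<^sup>2"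
      unfolding cmod_power2 by (simp add: power2_eq_square algebra_simps)
    ultimately show ?thesis
      using c by (simp add: field_simps)
  qed
  finally show ?thesis unfolding n\<zeta> unfolding \<zeta>_def .
qed

lemma moebius_angle_deriv_ge:
  assumes w: "cmod w < 1"
  shows "(1 - cmod w) / (1 + cmod w) \<le> (1 - (cmod w)\<^sup>2) / (cmod (1 - cis t * cnj w))\<^sup>2"
proof -
  have nz: "1 - cis t * cnj w \<noteq> 0"
    using w by (intro moebius_denominator_nonzero) auto
  have "cmod (1 - cis t * cnj w) \<le> 1 + cmod w"
    using norm_triangle_ineq4[of 1 "cis t * cnj w"] by (simp add: norm_mult)
  then have "(cmod (1 - cis t * cnj w))\<^sup>2 \<le> (1 + cmod w)\<^sup>2"
    by (intro power_mono) auto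
  moreover have "(1 - cmod w) / (1 + cmod w) = (1 - (cmod w)\<^sup>2) / (1 + cmod w)\<^sup>2"
  proof -
    have "1 + cmod w \<noteq> 0" using norm_ge_zero[of w] by linarith
    moreover have "1 - (cmod w)\<^sup>2 = (1 - cmod w) * (1 + cmod w)" by (simp add: power2_eq_square algebra_simps)
    ultimately show ?thesis by (simp add: power2_eq_square)
  qed
  ultimately show ?thesis
    using w nz by (simp only:) (intro divide_left_mono mult_pos_pos; simp add: power_le_one add_pos_nonneg add_nonneg_eq_0_iff)
qed

text \<open>Since the derivative of the angle map is bounded below by a positive constant, composition
  with \<open>disc_moebius w\<close> increases integrals over the circle by at most a constant
  factor, and in particular preserves null sets.\<close>

lemma moebius_substitution:
  fixes f :: "real \<Rightarrow> ennreal"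
  assumes w: "cmod w < 1" and [measurable]: "f \<in> borel_measurable borel"
  shows "(\<integral>\<^sup>+ t. f (moebius_angle w t) * indicator {0..2 * pi} t \<partial>lborel)
    \<le> ennreal ((1 + cmod w) / (1 - cmod w)) *
      (\<integral>\<^sup>+ t. f t * indicator {moebius_angle w 0..moebius_angle w 0 + 2 * pi} t \<partial>lborel)"
proof -
  define D where "D t = (1 - (cmod w)\<^sup>2) / (cmod (1 - cis t * cnj w))\<^sup>2" for t
  have D: "(1 - cmod w) / (1 + cmod w) \<le> D t" for t
    unfolding D_def by (rule moebius_angle_deriv_ge[OF w])
  have c: "0 < (1 - cmod w) / (1 + cmod w)"
    using w by (intro divide_pos_pos) (auto intro: add_pos_nonneg)
  have D0: "0 \<le> D t" for t using D[of t] c by linarith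
  have nz: "1 - cis t * cnj w \<noteq> 0" for t
    using w by (intro moebius_denominator_nonzero) auto
  have cD: "continuous_on S D" for S
    unfolding D_def[abs_def] by (intro continuous_intros) (use nz in auto)
  have "continuous_on UNIV (moebius_angle w)"
    by (intro continuous_at_imp_continuous_on ballI DERIV_isCont[OF moebius_angle_deriv[OF w]])
  then have [measurable]: "moebius_angle w \<in> borel_measurable borel" "D \<in> borel_measurable borel"
    using cD by (auto intro: borel_measurable_continuous_onI)
  have "(\<integral>\<^sup>+ t. f t * indicator {moebius_angle w 0..moebius_angle w (2 * pi)} t \<partial>lborel)
      = (\<integral>\<^sup>+ t. f (moebius_angle w t) * ennreal (D t) * indicator {0..2 * pi} t \<partial>lborel)"
    by (rule nn_integral_substitution_aux) (auto simp: D_def[symmetric] D0 cD moebius_angle_deriv[OF w, folded D_def])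
  moreover have "moebius_angle w (2 * pi) = moebius_angle w 0 + 2 * pi"
    by (simp add: moebius_angle_def)
  moreover have "(\<integral>\<^sup>+ t. f (moebius_angle w t) * indicator {0..2 * pi} t \<partial>lborel) \<le>
     (\<integral>\<^sup>+ t. ennreal ((1 + cmod w) / (1 - cmod w)) * (f (moebius_angle w t) * ennreal (D t) * indicator {0..2 * pi} t) \<partial>lborel)"
  proof (rule nn_integral_mono)
    fix t
    have "(1 + cmod w) / (1 - cmod w) * ((1 - cmod w) / (1 + cmod w)) \<le> (1 + cmod w) / (1 - cmod w) * D t"
      using w by (intro mult_left_mono D divide_nonneg_pos) auto
    moreover have "(1 + cmod w) / (1 - cmod w) * ((1 - cmod w) / (1 + cmod w)) = 1"
      using c w by (auto simp: divide_simps)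
    ultimately have "ennreal 1 \<le> ennreal ((1 + cmod w) / (1 - cmod w) * D t)"
      by (intro ennreal_leI) simp
    then have "1 \<le> ennreal ((1 + cmod w) / (1 - cmod w)) * ennreal (D t)"
      using w D0 by (subst ennreal_mult[symmetric]) simp_all
    then have "f (moebius_angle w t) * indicator {0..2 * pi} t * 1 \<le>
        f (moebius_angle w t) * indicator {0..2 * pi} t * (ennreal ((1 + cmod w) / (1 - cmod w)) * ennreal (D t))"
      by (rule mult_left_mono) simp
    then show "f (moebius_angle w t) * indicator {0..2 * pi} t \<le>
        ennreal ((1 + cmod w) / (1 - cmod w)) * (f (moebius_angle w t) * ennreal (D t) * indicator {0..2 * pi} t)"
      by (simp add: mult_ac)
  qed
  ultimately show ?thesis
    by (simp add: nn_integral_cmult)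
qed

lemma circle_integral_moebius_le:
  assumes w: "cmod w < 1" and [measurable]: "u \<in> borel_measurable borel"
  shows "circle_integral (\<lambda>z. u (disc_moebius w z)) \<le> ennreal ((1 + cmod w) / (1 - cmod w)) * circle_integral u"
  using moebius_substitution[OF w, of "\<lambda>t. u (cis t)"]
  by (simp add: circle_integral_def cis_moebius_angle[OF w] circle_integral_shift[unfolded circle_integral_def])

lemma AE_moebius:
  assumes w: "cmod w < 1" and P: "AE t in lborel. P (cis t)"
  shows "AE t in lborel. P (disc_moebius w (cis t))"
proof (rule AE_line_if_circle)
  obtain N where N: "{t \<in> space lborel. \<not> P (cis t)} \<subseteq> N" "emeasure lborel N = 0" "N \<in> sets lborel"
    using AE_E[OF P] .
  have [measurable]: "N \<in> sets borel" using N(3) by simp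
  have "continuous_on UNIV (moebius_angle w)"
    by (intro continuous_at_imp_continuous_on ballI DERIV_isCont[OF moebius_angle_deriv[OF w]])
  then have [measurable]: "moebius_angle w \<in> borel_measurable borel"
    by (rule borel_measurable_continuous_onI)
  have "(\<integral>\<^sup>+ t. indicator N t * indicator {moebius_angle w 0..moebius_angle w 0 + 2 * pi} t \<partial>lborel)
      \<le> (\<integral>\<^sup>+ t. indicator N t \<partial>lborel)"
    by (intro nn_integral_mono) (auto split: split_indicator)
  also have "\<dots> = 0" using N by simp
  finally have "(\<integral>\<^sup>+ t. indicator N (moebius_angle w t) * indicator {0..2 * pi} t \<partial>lborel) = (0 :: ennreal)"
    using moebius_substitution[OF w, of "indicator N"] by simp
  then have "AE t in lborel. indicator N (moebius_angle w t) * indicator {0..2 * pi} t = (0 :: ennreal)"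
    by (subst (asm) nn_integral_0_iff_AE) auto
  then show "AE t in lborel. t \<in> {0..2 * pi} \<longrightarrow> P (disc_moebius w (cis t))"
  proof eventually_elim
    case (elim t)
    show ?case
    proof
      assume "t \<in> {0..2 * pi}"
      with elim have "moebius_angle w t \<notin> N" by (auto split: split_indicator_asm)
      then have "P (cis (moebius_angle w t))" using N(1) by auto
      then show "P (disc_moebius w (cis t))" by (simp add: cis_moebius_angle[OF w])
    qed
  qed
qed

section \<open>Logarithmic means of boundary values\<close>

lemma ln_max_lipschitz:
  assumes e: "0 < (e :: real)"
  shows "\<bar>ln (max x e) - ln (max y e)\<bar> \<le> \<bar>x - y\<bar> / e"
proof -
  have *: "ln (max x e) - ln (max y e) \<le> (x - y) / e" if "y \<le> x" for x y
  proof -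
    have "ln (max x e) - ln (max y e) = ln (max x e / max y e)"
      using e by (simp add: ln_div max_def)
    also have "\<dots> \<le> max x e / max y e - 1"
      using e by (intro ln_le_minus_one divide_pos_pos) (auto simp: max_def)
    also have "\<dots> = (max x e - max y e) / max y e"
      using e by (simp add: diff_divide_distrib max_def)
    also have "\<dots> \<le> (x - y) / e"
      using e that by (intro frac_le) (auto simp: max_def)
    finally show ?thesis .
  qed
  have mono: "ln (max y e) \<le> ln (max x e)" if "y \<le> x" for x y
    using e that by (auto simp: max_def)
  show ?thesis
  proof (cases "y \<le> x")
    case True
    then show ?thesis using *[of y x] mono[of y x] by simp
  next
    case False
    then show ?thesis using *[of x y] mono[of x y] by (simp add: abs_minus_commute)
  qed
qed

context l2_power_series
begin

context
  fixes w :: complex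
  assumes w: "cmod w < 1"
begin

abbreviation (input) "v t \<equiv> cmod (boundary_value (disc_moebius w (cis t)))"
abbreviation (input) "vk k t \<equiv> cmod (phi (rad k *\<^sub>R disc_moebius w (cis t)))"

lemma moebius_boundary_value_finite: "circle_integral (\<lambda>z. ennreal (cmod (boundary_value (disc_moebius w z)))) < \<infinity>"
  by (rule le_less_trans[OF circle_integral_moebius_le[OF w]])
    (use boundary_value_finite_L1 in \<open>simp_all add: ennreal_mult_less_top\<close>)

lemma set_integrable_log_max:
  assumes e: "0 < e"
  shows "set_integrable lborel {0..2 * pi} (\<lambda>t. ln (max (v t) e))"
proof -
  have "set_integrable lborel {0..2 * pi} (\<lambda>t. \<bar>ln e\<bar> + v t / e)"
  proof (intro set_integral_add)
    show "set_integrable lborel {0..2 * pi} (\<lambda>t. \<bar>ln e\<bar>)"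
      by (intro borel_integrable_atLeastAtMost' continuous_intros)
    have "set_integrable lborel {0..2 * pi} v"
      unfolding set_integrable_def
    proof (rule integrableI_bounded)
      have "(\<integral>\<^sup>+ t. ennreal (norm (indicator {0..2 * pi} t *\<^sub>R v t)) \<partial>lborel) = circle_integral (\<lambda>z. ennreal (cmod (boundary_value (disc_moebius w z))))"
        unfolding circle_integral_def by (intro nn_integral_cong) (simp split: split_indicator)
      then show "(\<integral>\<^sup>+ t. ennreal (norm (indicator {0..2 * pi} t *\<^sub>R v t)) \<partial>lborel) < \<infinity>"
        using moebius_boundary_value_finite by simp
    qed simp
    then show "set_integrable lborel {0..2 * pi} (\<lambda>t. v t / e)"
      by (rule set_integrable_divide)
  qed
  then show ?thesis
  proof (rule set_integrable_bound)
    have "\<bar>ln (max x e)\<bar> \<le> \<bar>ln e\<bar> + x / e" if "0 \<le> x" for x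
    proof -
      have "max 0 e = e" "\<bar>x - 0\<bar> = x" using e that by simp_all
      then have "\<bar>ln (max x e) - ln e\<bar> \<le> x / e"
        using ln_max_lipschitz[OF e, of x 0] by (simp only:)
      then show ?thesis by linarith
    qed
    then have "norm (ln (max (v t) e)) \<le> norm (\<bar>ln e\<bar> + v t / e)" for t
      using e by (simp add: abs_of_nonneg)
    then show "AE t in lborel. t \<in> {0..2 * pi} \<longrightarrow> norm (ln (max (v t) e)) \<le> norm (\<bar>ln e\<bar> + v t / e)"
      by simp
  qed (simp add: set_borel_measurable_def)
qed

text \<open>Jensen's inequality for \<open>z \<mapsto> phi (rad k \<cdot> disc_moebius w z)\<close> and
  the limit \<open>k \<rightarrow> \<infinity>\<close>. The truncation at \<open>e\<close> makes
  the logarithm Lipschitz, so that \<open>L\<^sup>1\<close> convergence suffices.\<close>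

lemma log_phi_le_log_max:
  assumes e: "0 < e" and nz: "phi w \<noteq> 0"
  shows "2 * pi * ln (cmod (phi w)) \<le> (LINT t:{0..2 * pi}|lborel. ln (max (v t) e))"
proof -
  let ?A = "{0..2 * pi :: real}"
  let ?I = "LINT t:?A|lborel. ln (max (v t) e)"
  have in_disc: "cmod (rad k *\<^sub>R disc_moebius w z) < 1" if "cmod z \<le> 1" for z k
    using cmod_disc_moebius_le[OF w that] rad(1,2)[of k] mult_left_le[of "cmod (disc_moebius w z)" "rad k"] by simp
  have hol: "(\<lambda>z. phi (rad k *\<^sub>R disc_moebius w z)) holomorphic_on cball 0 1" for k
    unfolding scaleR_conv_of_real
    by (rule holomorphic_on_compose_gen[OF _ holomorphic_phi, unfolded o_def])
      (use in_disc[of _ k] in \<open>auto intro!: holomorphic_intros holomorphic_disc_moebius[OF w] simp: scaleR_conv_of_real\<close>)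
  have cont: "continuous_on S (\<lambda>z. ln (max (cmod (phi (rad k *\<^sub>R disc_moebius w z))) e))" if "S \<subseteq> cball 0 1" for S k
    using e that by (intro continuous_intros holomorphic_on_imp_continuous_on[OF hol, THEN continuous_on_subset]) (auto simp: max_def)
  have intk: "set_integrable lborel ?A (\<lambda>t. ln (max (vk k t) e))" for k
    by (intro borel_integrable_atLeastAtMost' continuous_on_compose2[OF cont[OF sphere_cball]] continuous_intros) auto
  let ?Ik = "\<lambda>k. LINT t:?A|lborel. ln (max (vk k t) e)"
  have jensen: "2 * pi * ln (cmod (phi (rad k *\<^sub>R w))) \<le> ?Ik k" if "phi (rad k *\<^sub>R w) \<noteq> 0" for k
  proof -
    have "cmod (phi (rad k *\<^sub>R disc_moebius w 0)) \<le> exp (integral ?A (\<lambda>t. ln (max (vk k t) e)) / (2 * pi))"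
    proof (rule jensen_inequality_majorant[of _ "\<lambda>z. ln (max (cmod (phi (rad k *\<^sub>R disc_moebius w z))) e)"])
      show "(\<lambda>z. phi (rad k *\<^sub>R disc_moebius w z)) holomorphic_on ball 0 1"
        by (rule holomorphic_on_subset[OF hol]) auto
      show "cmod (phi (rad k *\<^sub>R disc_moebius w z)) \<le> exp (ln (max (cmod (phi (rad k *\<^sub>R disc_moebius w z))) e))" for z
        using e by (subst exp_ln) (simp_all add: less_max_iff_disj)
    qed (auto intro!: cont holomorphic_on_imp_continuous_on[OF hol])
    then have "ln (cmod (phi (rad k *\<^sub>R w))) \<le> ln (exp (integral ?A (\<lambda>t. ln (max (vk k t) e)) / (2 * pi)))"
      using that by (subst ln_le_cancel_iff) auto
    then have "ln (cmod (phi (rad k *\<^sub>R w))) \<le> ?Ik k / (2 * pi)"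
      by (simp add: set_borel_integral_eq_integral(2)[OF intk])
    then show ?thesis by (simp add: field_simps)
  qed
  have diff: "\<bar>?Ik k - ?I\<bar> \<le> (1 + cmod w) / (1 - cmod w) * (5 * pi) / e * (1 / 2) ^ k" for k
  proof -
    have "?Ik k - ?I = (LINT t:?A|lborel. ln (max (vk k t) e) - ln (max (v t) e))"
      by (intro set_integral_diff(2)[symmetric] intk set_integrable_log_max e)
    then have "ennreal \<bar>?Ik k - ?I\<bar> \<le> (\<integral>\<^sup>+ t. ennreal (norm (indicator ?A t *\<^sub>R (ln (max (vk k t) e) - ln (max (v t) e)))) \<partial>lborel)"
      using integral_norm_bound_ennreal[OF set_integral_diff(1)[OF intk[of k] set_integrable_log_max[OF e], unfolded set_integrable_def]]
      by (simp only: set_lebesgue_integral_def real_norm_def)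
    also have "\<dots> \<le> (\<integral>\<^sup>+ t. ennreal (1 / e) * (ennreal (cmod (phi (rad k *\<^sub>R disc_moebius w (cis t)) - boundary_value (disc_moebius w (cis t)))) * indicator ?A t) \<partial>lborel)"
    proof (rule nn_integral_mono)
      fix t
      have "\<bar>ln (max (vk k t) e) - ln (max (v t) e)\<bar> \<le> \<bar>vk k t - v t\<bar> / e"
        by (rule ln_max_lipschitz[OF e])
      also have "\<dots> \<le> 1 / e * cmod (phi (rad k *\<^sub>R disc_moebius w (cis t)) - boundary_value (disc_moebius w (cis t)))"
        using e norm_triangle_ineq3[of "phi (rad k *\<^sub>R disc_moebius w (cis t))" "boundary_value (disc_moebius w (cis t))"]
        by (simp add: divide_right_mono)
      finally show "ennreal (norm (indicator ?A t *\<^sub>R (ln (max (vk k t) e) - ln (max (v t) e)))) \<le>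
          ennreal (1 / e) * (ennreal (cmod (phi (rad k *\<^sub>R disc_moebius w (cis t)) - boundary_value (disc_moebius w (cis t)))) * indicator ?A t)"
        using e by (auto simp: ennreal_mult[symmetric] intro!: ennreal_leI split: split_indicator)
    qed
    also have "\<dots> = ennreal (1 / e) * circle_integral (\<lambda>z. ennreal (cmod (phi (rad k *\<^sub>R disc_moebius w z) - boundary_value (disc_moebius w z))))"
      unfolding circle_integral_def by (rule nn_integral_cmult) simp
    also have "\<dots> \<le> ennreal (1 / e) * (ennreal ((1 + cmod w) / (1 - cmod w)) * ennreal (5 * pi * (1 / 2) ^ k))"
      by (intro mult_left_mono order.trans[OF circle_integral_moebius_le[OF w, of "\<lambda>z. ennreal (cmod (phi (rad k *\<^sub>R z) - boundary_value z))"]] boundary_value_L1) simp_all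
    also have "\<dots> = ennreal ((1 + cmod w) / (1 - cmod w) * (5 * pi) / e * (1 / 2) ^ k)"
      using e w by (simp add: ennreal_mult[symmetric] field_simps)
    finally show ?thesis
      using e w by (subst (asm) ennreal_le_iff) auto
  qed
  have Ik: "?Ik \<longlonglongrightarrow> ?I"
  proof (rule LIM_zero_cancel, rule Lim_null_comparison)
    show "\<forall>\<^sub>F k in sequentially. norm (?Ik k - ?I) \<le> (1 + cmod w) / (1 - cmod w) * (5 * pi) / e * (1 / 2) ^ k"
      using diff by simp
    show "(\<lambda>k. (1 + cmod w) / (1 - cmod w) * (5 * pi) / e * (1 / 2) ^ k) \<longlonglongrightarrow> 0"
      by (intro tendsto_mult_right_zero LIMSEQ_power_zero) simp
  qed
  have "isCont phi w"
    using holomorphic_on_imp_continuous_on[OF holomorphic_phi] w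
    by (simp add: continuous_on_eq_continuous_at)
  then have phik: "(\<lambda>k. phi (rad k *\<^sub>R w)) \<longlonglongrightarrow> phi w"
    by (rule isCont_tendsto_compose) (use tendsto_scaleR[OF tendsto_rad tendsto_const, of w] in simp)
  then have "(\<lambda>k. 2 * pi * ln (cmod (phi (rad k *\<^sub>R w)))) \<longlonglongrightarrow> 2 * pi * ln (cmod (phi w))"
    using nz by (intro tendsto_intros) auto
  moreover have "\<forall>\<^sub>F k in sequentially. 2 * pi * ln (cmod (phi (rad k *\<^sub>R w))) \<le> ?Ik k"
    using tendsto_imp_eventually_ne[OF phik nz] by eventually_elim (rule jensen)
  ultimately show ?thesis
    using Ik by (intro tendsto_le[OF trivial_limit_sequentially])
qed

end

text \<open>The truncation is removed with Fatou's lemma for the negative part of the logarithm.\<close>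

lemma elog_phi_le:
  assumes w: "cmod w < 1"
  shows "elog (cmod (phi w)) \<le> ereal (1 / (2 * pi)) *
    ext_integral (restrict_space lborel {0..2 * pi}) (\<lambda>t. elog (cmod (boundary_value (disc_moebius w (cis t)))))"
proof (cases "phi w = 0")
  case True
  then show ?thesis by (simp add: elog_def)
next
  case nz: False
  let ?A = "{0..2 * pi :: real}"
  let ?v = "\<lambda>t. cmod (boundary_value (disc_moebius w (cis t)))"
  let ?m = "2 * pi * ln (cmod (phi w))"
  define pos where "pos = (\<integral>\<^sup>+ t. e2ennreal (elog (?v t)) \<partial>restrict_space lborel ?A)"
  define neg where "neg = (\<integral>\<^sup>+ t. e2ennreal (- elog (?v t)) \<partial>restrict_space lborel ?A)"
  \<comment> \<open>Truncation levels at most 1, so that the positive part of the logarithm is not affected.\<close>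
  define eps where "eps n = 1 / real (Suc n)" for n
  have eps: "0 < eps n" "eps n \<le> 1" for n by (auto simp: eps_def)
  define negk where "negk n = (\<integral>\<^sup>+ t. ennreal (- ln (max (?v t) (eps n))) \<partial>restrict_space lborel ?A)" for n
  have posk: "pos = (\<integral>\<^sup>+ t. ennreal (ln (max (?v t) (eps n))) \<partial>restrict_space lborel ?A)" for n
    unfolding pos_def
  proof (rule nn_integral_cong)
    fix t
    show "e2ennreal (elog (?v t)) = ennreal (ln (max (?v t) (eps n)))"
      using eps[of n] by (auto simp: elog_def e2ennreal_neg max_def ennreal_neg)
  qed
  have int: "integrable (restrict_space lborel ?A) (\<lambda>t. ln (max (?v t) (eps n)))" for n
    using set_integrable_log_max[OF w eps(1)] unfolding set_integrable_def
    by (subst integrable_restrict_space) auto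
  have pos_fin: "pos < \<infinity>" 
    using int[of 0] unfolding posk[of 0] by (simp add: real_integrable_def less_top)
  have negk: "negk n \<le> ennreal (enn2real pos - ?m)" "0 \<le> enn2real pos - ?m" for n
  proof -
    have "?m \<le> (LINT t:?A|lborel. ln (max (?v t) (eps n)))"
      by (rule log_phi_le_log_max[OF w eps(1) nz])
    also have "\<dots> = integral\<^sup>L (restrict_space lborel ?A) (\<lambda>t. ln (max (?v t) (eps n)))"
      unfolding set_lebesgue_integral_def by (subst integral_restrict_space) auto
    also have "\<dots> = enn2real pos - enn2real (negk n)"
      unfolding real_lebesgue_integral_def[OF int] posk[of n] negk_def ..
    finally have *: "enn2real (negk n) \<le> enn2real pos - ?m" by simp
    have "negk n \<noteq> \<infinity>"
      using int[of n] unfolding negk_def by (simp add: real_integrable_def)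
    then show "negk n \<le> ennreal (enn2real pos - ?m)"
      using ennreal_leI[OF *] by (simp add: less_top)
    show "0 \<le> enn2real pos - ?m"
      using * enn2real_nonneg[of "negk n"] by linarith
  qed
  have lim: "(\<lambda>n. ennreal (- ln (max x (eps n)))) \<longlonglongrightarrow> e2ennreal (- elog x)" if "0 \<le> x" for x
  proof (cases "x = 0")
    case True
    have "(\<lambda>n. ennreal (ln (real (Suc n)))) \<longlonglongrightarrow> top"
      unfolding ennreal_tendsto_top_eq_at_top
      by (intro filterlim_compose[OF ln_at_top] filterlim_compose[OF filterlim_real_sequentially] filterlim_Suc)
    moreover have "- ln (max x (eps n)) = ln (real (Suc n))" for n
      using True by (simp add: eps_def ln_div)
    ultimately show ?thesis using True by (simp add: elog_def)
  next
    case False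
    then have x: "0 < x" using that by simp
    have "eps \<longlonglongrightarrow> 0"
      unfolding eps_def using LIMSEQ_inverse_real_of_nat by (simp add: inverse_eq_divide)
    then have "\<forall>\<^sub>F n in sequentially. eps n < x"
      using x by (rule order_tendstoD)
    then have "\<forall>\<^sub>F n in sequentially. ennreal (- ln (max x (eps n))) = e2ennreal (- elog x)"
      by eventually_elim (use x in \<open>simp add: elog_def max_def\<close>)
    then show ?thesis by (rule tendsto_eventually)
  qed
  have "neg = (\<integral>\<^sup>+ t. liminf (\<lambda>n. ennreal (- ln (max (?v t) (eps n)))) \<partial>restrict_space lborel ?A)"
    unfolding neg_def by (intro nn_integral_cong lim_imp_Liminf[symmetric] lim) auto
  also have "\<dots> \<le> liminf negk"
    unfolding negk_def by (intro nn_integral_liminf borel_measurable_integrable measurable_compose[OF _ measurable_ennreal] borel_measurable_uminus int)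
  also have "\<dots> \<le> liminf (\<lambda>n::nat. ennreal (enn2real pos - ?m))"
    by (intro Liminf_mono always_eventually allI negk)
  finally have neg: "neg \<le> ennreal (enn2real pos - ?m)"
    by (simp add: Liminf_const)
  define p where "p = enn2real pos"
  define q where "q = enn2real neg"
  have p: "pos = ennreal p" "0 \<le> p" using pos_fin by (simp_all add: p_def)
  have q: "neg = ennreal q" "0 \<le> q" using neg by (simp_all add: q_def) (metis ennreal_enn2real ennreal_less_top le_less_trans)
  have "q \<le> p - ?m"
    using neg negk(2) by (simp add: q p_def[symmetric] q(2))
  then have "?m / (2 * pi) \<le> (p - q) / (2 * pi)"
    by (intro divide_right_mono) auto
  then have "ln (cmod (phi w)) \<le> 1 / (2 * pi) * (p - q)" by simp
  moreover have "ext_integral (restrict_space lborel ?A) (\<lambda>t. elog (?v t)) = ereal (p - q)"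
    unfolding ext_integral_def pos_def[symmetric] neg_def[symmetric] by (simp add: p q)
  ultimately show ?thesis
    using nz by (simp add: elog_def)
qed

end

section \<open>Restriction to a slice\<close>

text \<open>The identification of the complex plane with the slice \<open>\<real> + \<real> I\<close>.\<close>

definition slice_emb :: "quat \<Rightarrow> complex \<Rightarrow> quat"
  where "slice_emb I z = of_real (Re z) + Im z *\<^sub>R I"

text \<open>The orthogonal projection of the quaternions onto the slice of \<open>I\<close>, read as a
  complex number. It is linear over the slice acting from the left (lemma
  \<open>slice_proj_mult\<close>).\<close>

definition slice_proj :: "quat \<Rightarrow> quat \<Rightarrow> complex"
  where "slice_proj I q = Complex (qre q) (q \<bullet> I)"

lemma imag_unit_components:
  assumes "I \<in> imag_units"
  shows "qre I = 0" "qim1 I * qim1 I + qim2 I * qim2 I + qim3 I * qim3 I = 1"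
  using assms by (auto simp: imag_units_iff norm_quat_def power2_eq_square)

lemma slice_emb_simps [simp]:
  "slice_emb I 0 = 0" "slice_emb I 1 = 1"
  "slice_emb I (z - z') = slice_emb I z - slice_emb I z'"
  "slice_emb I (r *\<^sub>R z) = r *\<^sub>R slice_emb I z"
  by (simp_all add: slice_emb_def quat_eq_iff algebra_simps)

lemma slice_emb_cis: "slice_emb I (cis t) = qcis I t"
  by (simp add: slice_emb_def qcis_def)

lemma slice_emb_mult:
  assumes "I \<in> imag_units"
  shows "slice_emb I (z * z') = slice_emb I z * slice_emb I z'"
proof -
  have "I * I = - 1" using assms by (simp add: imag_units_def power2_eq_square)
  then show ?thesis
    by (simp add: slice_emb_def algebra_simps scaleR_conv_of_real[symmetric] of_real_def)
qed

lemma slice_emb_power: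
  assumes "I \<in> imag_units"
  shows "slice_emb I (z ^ n) = slice_emb I z ^ n"
  by (induction n) (simp_all add: slice_emb_mult[OF assms])

lemma norm_slice_emb:
  assumes "I \<in> imag_units"
  shows "norm (slice_emb I z) = cmod z"
proof -
  have "(norm (slice_emb I z))\<^sup>2 = (Re z)\<^sup>2 + (Im z)\<^sup>2 * (qim1 I * qim1 I + qim2 I * qim2 I + qim3 I * qim3 I)"
    unfolding power2_norm_eq_inner
    by (simp add: inner_quat_def slice_emb_def imag_unit_components(1)[OF assms] power2_eq_square algebra_simps)
  then show ?thesis
    unfolding imag_unit_components(2)[OF assms] by (simp add: cmod_def real_sqrt_unique)
qed

lemma slice_emb_inverse:
  assumes "I \<in> imag_units"
  shows "slice_emb I (inverse z) = inverse (slice_emb I z)"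
proof (cases "z = 0")
  case False
  then have "slice_emb I z * slice_emb I (inverse z) = 1"
    by (simp add: slice_emb_mult[OF assms, symmetric])
  then show ?thesis by (rule inverse_unique[symmetric])
qed simp

lemma qcnj_slice_emb:
  assumes "I \<in> imag_units"
  shows "qcnj (slice_emb I z) = slice_emb I (cnj z)"
  using imag_unit_components(1)[OF assms] by (simp add: slice_emb_def quat_eq_iff)

lemma slice_moebius_emb:
  assumes "I \<in> imag_units"
  shows "slice_moebius (slice_emb I w) (slice_emb I z) = slice_emb I (disc_moebius w z)"
proof -
  have "disc_moebius w z = inverse (1 - z * cnj w) * (w - z)"
    by (simp add: disc_moebius_def divide_inverse mult.commute)
  then show ?thesis
    by (simp add: slice_moebius_def qcnj_slice_emb[OF assms] slice_emb_mult[OF assms] slice_emb_inverse[OF assms])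
qed

lemma bounded_linear_slice_proj: "bounded_linear (slice_proj I)"
proof
  show "\<exists>K. \<forall>q. cmod (slice_proj I q) \<le> norm q * K"
  proof (intro exI allI)
    fix q
    have "cmod (slice_proj I q) \<le> \<bar>qre q\<bar> + \<bar>q \<bullet> I\<bar>"
      using cmod_le[of "slice_proj I q"] by (simp add: slice_proj_def)
    also have "\<bar>qre q\<bar> \<le> norm q"
      using Cauchy_Schwarz_ineq2[of q 1] by (simp add: inner_quat_def)
    also have "\<bar>q \<bullet> I\<bar> \<le> norm q * norm I"
      by (rule Cauchy_Schwarz_ineq2)
    finally show "cmod (slice_proj I q) \<le> norm q * (1 + norm I)"
      by (simp add: algebra_simps)
  qed
qed (simp_all add: slice_proj_def inner_add_left complex_eq_iff)

lemma cmod_slice_proj_le: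
  assumes "I \<in> imag_units"
  shows "cmod (slice_proj I q) \<le> norm q"
proof -
  let ?q = "q - of_real (qre q)"
  have "\<bar>?q \<bullet> I\<bar> \<le> norm ?q * norm I" by (rule Cauchy_Schwarz_ineq2)
  then have "\<bar>q \<bullet> I\<bar> \<le> norm ?q"
    using assms by (simp add: inner_quat_def imag_units_iff)
  then have "(q \<bullet> I)\<^sup>2 \<le> (norm ?q)\<^sup>2"
    using abs_le_square_iff[of "q \<bullet> I" "norm ?q"] by simp
  then have "(cmod (slice_proj I q))\<^sup>2 \<le> (norm q)\<^sup>2"
    unfolding cmod_power2 by (simp add: slice_proj_def norm_quat_def)
  then show ?thesis by (rule power2_le_imp_le) simp
qed

lemma slice_proj_mult:
  assumes "I \<in> imag_units"
  shows "slice_proj I (slice_emb I z * q) = z * slice_proj I q"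
proof -
  define a b c where abc: "a = qim1 I" "b = qim2 I" "c = qim3 I"
  have I: "qre I = 0" "a * a + b * b + c * c = 1"
    using imag_unit_components[OF assms] by (simp_all add: abc)
  have "(slice_emb I z * q) \<bullet> I = Re z * (q \<bullet> I) + Im z * qre q * (a * a + b * b + c * c)"
    by (simp add: inner_quat_def slice_emb_def I(1) abc[symmetric] algebra_simps)
  then show ?thesis
    unfolding I(2) by (simp add: complex_eq_iff slice_proj_def inner_quat_def slice_emb_def I(1) algebra_simps)
qed

lemma Re_slice_proj_mult_qcnj: "Re (slice_proj I (q * qcnj b)) = q \<bullet> b"
  by (simp add: slice_proj_def inner_quat_def)

lemma slice_proj_of_real:
  assumes "I \<in> imag_units"
  shows "slice_proj I (of_real r) = of_real r"
  using imag_unit_components(1)[OF assms] by (simp add: slice_proj_def inner_quat_def complex_eq_iff)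

text \<open>The projection of \<open>h c\<close> to a slice is a scalar Hardy space function, for every
  quaternion \<open>c\<close>.\<close>

lemma slice_component:
  assumes I: "I \<in> imag_units"
    and a: "summable (\<lambda>n. (norm (a n))\<^sup>2)" and h: "\<And>q. q \<in> ball 0 1 \<Longrightarrow> (\<lambda>n. q ^ n * a n) sums h q"
  shows "l2_power_series (\<lambda>n. slice_proj I (a n * c))"
    and "cmod z < 1 \<Longrightarrow> l2_power_series.phi (\<lambda>n. slice_proj I (a n * c)) z = slice_proj I (h (slice_emb I z) * c)"
proof -
  show l2: "l2_power_series (\<lambda>n. slice_proj I (a n * c))"
  proof
    have "(cmod (slice_proj I (a n * c)))\<^sup>2 \<le> (norm (a n))\<^sup>2 * (norm c)\<^sup>2" for n
      unfolding power_mult_distrib[symmetric] norm_mult[symmetric]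
      by (intro power_mono cmod_slice_proj_le I norm_ge_zero)
    then show "summable (\<lambda>n. (cmod (slice_proj I (a n * c)))\<^sup>2)"
      by (intro summable_comparison_test[OF _ summable_mult2[OF a]]) auto
  qed
  interpret l2_power_series "\<lambda>n. slice_proj I (a n * c)" by (rule l2)
  assume z: "cmod z < 1"
  then have "(\<lambda>n. slice_emb I z ^ n * a n) sums h (slice_emb I z)"
    using norm_slice_emb[OF I, of z] by (intro h) simp
  then have "(\<lambda>n. slice_proj I (slice_emb I z ^ n * a n * c)) sums slice_proj I (h (slice_emb I z) * c)"
    by (intro bounded_linear.sums[OF bounded_linear_slice_proj] sums_mult2)
  moreover have "slice_proj I (slice_emb I z ^ n * a n * c) = slice_proj I (a n * c) * z ^ n" for n
    by (simp add: slice_emb_power[OF I, symmetric] mult.assoc slice_proj_mult[OF I])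
  ultimately show "phi z = slice_proj I (h (slice_emb I z) * c)"
    using sums_phi[OF z] by (simp add: sums_iff)
qed

text \<open>The four real components of \<open>h\<close> are the real parts of the slice projections of
  the product of \<open>h\<close> with \<open>qcnj b\<close>, \<open>b\<close> a basis vector.\<close>

lemma hardy2_radial_limit:
  assumes I: "I \<in> imag_units" and h: "h \<in> hardy2"
  shows "AE t in lborel. ((\<lambda>r. h (r *\<^sub>R qcis I t)) \<longlongrightarrow> radial_limit h (qcis I t)) (at_left 1)"
proof -
  obtain a where a: "summable (\<lambda>n. (norm (a n))\<^sup>2)" "\<And>q. q \<in> ball 0 1 \<Longrightarrow> (\<lambda>n. q ^ n * a n) sums h q"
    using h unfolding hardy2_def by blast
  have comp: "AE t in lborel. \<exists>l. ((\<lambda>r. h (r *\<^sub>R qcis I t) \<bullet> b) \<longlongrightarrow> l) (at_left 1)" for b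
  proof -
    interpret l2_power_series "\<lambda>n. slice_proj I (a n * qcnj b)"
      by (rule slice_component(1)[OF I a])
    show ?thesis
      using AE_radial_limit
    proof eventually_elim
      case (elim t)
      have "\<forall>\<^sub>F r in at_left (1::real). r \<in> {0<..<1}"
        by (rule eventually_at_leftI[of 0]) auto
      then have "\<forall>\<^sub>F r in at_left 1. Re (phi (r *\<^sub>R cis t)) = h (r *\<^sub>R qcis I t) \<bullet> b"
      proof eventually_elim
        case (elim r)
        then show ?case
          using slice_component(2)[OF I a, of "r *\<^sub>R cis t" "qcnj b"]
          by (simp add: Re_slice_proj_mult_qcnj slice_emb_cis)
      qed
      from Lim_transform_eventually[OF tendsto_Re[OF elim] this] show ?case ..
    qed
  qed
  have "AE t in lborel. \<forall>b\<in>(Basis :: quat set). \<exists>l. ((\<lambda>r. h (r *\<^sub>R qcis I t) \<bullet> b) \<longlongrightarrow> l) (at_left 1)"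
    by (rule AE_finite_allI[OF finite_Basis comp])
  then show ?thesis
  proof eventually_elim
    case (elim t)
    from bchoice[OF this] obtain l where l: "\<And>b. b \<in> Basis \<Longrightarrow> ((\<lambda>r. h (r *\<^sub>R qcis I t) \<bullet> b) \<longlongrightarrow> l b) (at_left 1)"
      by blast
    have "((\<lambda>r. h (r *\<^sub>R qcis I t)) \<longlongrightarrow> (\<Sum>b\<in>Basis. l b *\<^sub>R b)) (at_left 1)"
      by (subst tendsto_componentwise_iff) (simp add: l)
    then show ?case
      unfolding radial_limit_def by (simp add: tendsto_Lim)
  qed
qed

lemma elog_mono: "x \<le> y \<Longrightarrow> elog x \<le> elog y"
  by (auto simp: elog_def)

lemma elog_le_iff: "0 \<le> y \<Longrightarrow> elog x \<le> elog y \<longleftrightarrow> x \<le> y \<or> (x \<le> 0 \<and> y \<le> 0)"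
  by (auto simp: elog_def)

lemma ext_integral_mono_AE:
  assumes "AE x in M. u x \<le> v x"
  shows "ext_integral M u \<le> ext_integral M v"
proof -
  have "(\<integral>\<^sup>+ x. e2ennreal (u x) \<partial>M) \<le> (\<integral>\<^sup>+ x. e2ennreal (v x) \<partial>M)"
    by (intro nn_integral_mono_AE eventually_mono[OF assms] e2ennreal_mono)
  moreover have "(\<integral>\<^sup>+ x. e2ennreal (- v x) \<partial>M) \<le> (\<integral>\<^sup>+ x. e2ennreal (- u x) \<partial>M)"
    by (intro nn_integral_mono_AE eventually_mono[OF assms] e2ennreal_mono) simp
  ultimately show ?thesis
    unfolding ext_integral_def by (intro ereal_minus_mono) (simp_all add: less_eq_ennreal.rep_eq)
qed

text \<open>The unit quaternion \<open>c\<close> is chosen so that \<open>h c\<close> is a nonnegative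
  real at the given point. Then the slice projection of \<open>h c\<close> has the modulus of
  \<open>h\<close> at this point and at most the modulus of \<open>h\<close> elsewhere.\<close>

lemma hardy2_elog_le:
  assumes I: "I \<in> imag_units" and h: "h \<in> hardy2" and w: "cmod w < 1"
  shows "elog (norm (h (slice_emb I w))) \<le> ereal (1 / (2 * pi)) *
    ext_integral (restrict_space lborel {0..2 * pi})
      (\<lambda>t. elog (norm (radial_limit h (slice_emb I (disc_moebius w (cis t))))))"
proof (cases "h (slice_emb I w) = 0")
  case True
  then show ?thesis by (simp add: elog_def)
next
  case False
  define c where "c = norm (h (slice_emb I w)) *\<^sub>R inverse (h (slice_emb I w))"
  have c: "norm c = 1" using False by (simp add: c_def norm_inverse)
  obtain a where a: "summable (\<lambda>n. (norm (a n))\<^sup>2)" "\<And>q. q \<in> ball 0 1 \<Longrightarrow> (\<lambda>n. q ^ n * a n) sums h q"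
    using h unfolding hardy2_def by blast
  interpret l2_power_series "\<lambda>n. slice_proj I (a n * c)"
    by (rule slice_component(1)[OF I a])
  have "h (slice_emb I w) * c = of_real (norm (h (slice_emb I w)))"
    using False by (simp add: c_def of_real_def)
  then have phi_w: "cmod (phi w) = norm (h (slice_emb I w))"
    using slice_component(2)[OF I a w, of c] by (simp add: slice_proj_of_real[OF I])
  have "AE t in lborel. cmod (boundary_value (cis t)) \<le> norm (radial_limit h (slice_emb I (cis t)))"
    using AE_radial_limit hardy2_radial_limit[OF I h]
  proof eventually_elim
    case (elim t)
    have "\<forall>\<^sub>F r in at_left (1::real). r \<in> {0<..<1}"
      by (rule eventually_at_leftI[of 0]) auto
    then have "\<forall>\<^sub>F r in at_left 1. cmod (phi (r *\<^sub>R cis t)) \<le> norm (h (r *\<^sub>R qcis I t))"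
    proof eventually_elim
      case (elim r)
      then show ?case
        using slice_component(2)[OF I a, of "r *\<^sub>R cis t" c] cmod_slice_proj_le[OF I, of "h (r *\<^sub>R qcis I t) * c"] c
        by (simp add: slice_emb_cis norm_mult)
    qed
    then show ?case
      unfolding slice_emb_cis
      by (intro tendsto_le[OF _ tendsto_norm[OF elim(2)] tendsto_norm[OF elim(1)]]) simp_all
  qed
  from AE_moebius[OF w this]
  have "AE t in lborel. cmod (boundary_value (disc_moebius w (cis t))) \<le> norm (radial_limit h (slice_emb I (disc_moebius w (cis t))))" .
  then have "AE t in restrict_space lborel {0..2 * pi}. elog (cmod (boundary_value (disc_moebius w (cis t))))
      \<le> elog (norm (radial_limit h (slice_emb I (disc_moebius w (cis t)))))"
    by (subst AE_restrict_space_iff) (auto intro: elog_mono)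
  from ext_integral_mono_AE[OF this] have "ereal (1 / (2 * pi)) *
      ext_integral (restrict_space lborel {0..2 * pi}) (\<lambda>t. elog (cmod (boundary_value (disc_moebius w (cis t)))))
    \<le> ereal (1 / (2 * pi)) * ext_integral (restrict_space lborel {0..2 * pi})
      (\<lambda>t. elog (norm (radial_limit h (slice_emb I (disc_moebius w (cis t))))))"
    by (intro ereal_mult_left_mono) simp_all
  with elog_phi_le[OF w] show ?thesis
    unfolding phi_w by (rule order.trans)
qed

lemma continuous_on_hardy2:
  assumes "h \<in> hardy2"
  shows "continuous_on (ball 0 1) h"
proof -
  obtain a where a: "summable (\<lambda>n. (norm (a n))\<^sup>2)" "\<And>q. q \<in> ball 0 1 \<Longrightarrow> (\<lambda>n. q ^ n * a n) sums h q"
    using assms unfolding hardy2_def by blast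
  obtain K where K: "\<And>n. norm (a n) \<le> K"
    using square_summable_imp_bounded[OF a(1)] by blast
  have "continuous_on (ball 0 \<rho>) h" if \<rho>: "0 < \<rho>" "\<rho> < 1" for \<rho>
  proof -
    have "uniform_limit (ball 0 \<rho>) (\<lambda>n q. \<Sum>i<n. q ^ i * a i) (\<lambda>q. \<Sum>i. q ^ i * a i) sequentially"
    proof (rule Weierstrass_m_test)
      show "summable (\<lambda>n. \<rho> ^ n * K)"
        using \<rho> by (intro summable_mult2 summable_geometric) simp
      show "norm (q ^ n * a n) \<le> \<rho> ^ n * K" if "q \<in> ball 0 \<rho>" for n q
        unfolding norm_mult norm_power using that \<rho> K by (intro mult_mono power_mono) auto
    qed
    then have "continuous_on (ball 0 \<rho>) (\<lambda>q. \<Sum>i. q ^ i * a i)"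
      by (rule uniform_limit_theorem[rotated]) (auto intro!: always_eventually continuous_intros)
    then show ?thesis
      by (rule continuous_on_cong[THEN iffD1, rotated -1]) (use a(2) \<rho> in \<open>auto simp: sums_iff\<close>)
  qed
  then have "isCont h q" if "q \<in> ball 0 1" for q
  proof -
    have "norm q < 1" using that by simp
    then obtain \<rho> where "norm q < \<rho>" "\<rho> < 1" using dense by blast
    then have "continuous_on (ball 0 \<rho>) h" "q \<in> ball 0 \<rho>"
      using \<open>\<And>\<rho>. 0 < \<rho> \<Longrightarrow> \<rho> < 1 \<Longrightarrow> continuous_on (ball 0 \<rho>) h\<close>[of \<rho>] norm_ge_zero[of q] by auto
    then show ?thesis by (simp add: continuous_on_eq_continuous_at)
  qed
  then show ?thesis by (simp add: continuous_at_imp_continuous_on)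
qed

section \<open>Almost every slice\<close>

lemma AE_boundary_slices:
  assumes "AE q in boundary_measure. P q"
  shows "AE I in sphere_area. AE t in lborel. P (qcis I t)"
proof -
  let ?A = "restrict_space lborel {0..<2 * pi :: real}"
  let ?D = "distr (sphere_area \<Otimes>\<^sub>M ?A) borel (\<lambda>(I, t). qcis I t)"
  interpret angle: finite_measure ?A by (rule finite_angle)
  interpret pair_sigma_finite sphere_area ?A ..
  obtain N where N: "{q \<in> space boundary_measure. \<not> P q} \<subseteq> N" "emeasure boundary_measure N = 0" "N \<in> sets boundary_measure"
    using AE_E[OF assms] .
  have "emeasure ?D N = 0"
    using N(2) by (simp add: boundary_measure_def)
  moreover have "N \<in> sets ?D" "{q \<in> space ?D. \<not> P q} \<subseteq> N"
    using N(1,3) by (simp_all add: boundary_measure_def space_scale_measure)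
  ultimately have "AE q in ?D. P q"
    by (rule AE_I[rotated])
  then have "AE p in sphere_area \<Otimes>\<^sub>M ?A. P (case p of (I, t) \<Rightarrow> qcis I t)"
    by (rule AE_distrD[OF measurable_qcis_product])
  then have "AE I in sphere_area. AE t in ?A. P (case (I, t) of (I, t) \<Rightarrow> qcis I t)"
    by (rule AE_pair)
  then show ?thesis
  proof eventually_elim
    case (elim I)
    then have "AE t in lborel. t \<in> {0..<2 * pi} \<longrightarrow> P (qcis I t)"
      by (simp add: AE_restrict_space_iff)
    then have "AE t in lborel. t \<in> {0..2 * pi} \<longrightarrow> P (slice_emb I (cis t))"
      using AE_lborel_singleton[of "2 * pi"] by eventually_elim (auto simp: slice_emb_cis)
    from AE_line_if_circle[OF this] show ?case
      by (simp add: slice_emb_cis)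
  qed
qed

lemma sphere_point_surj:
  assumes "I \<in> imag_units"
  shows "\<exists>p\<in>cbox (0, 0) (pi, 2 * pi). sphere_point p = I"
proof -
  define x y z where "x = qim1 I" "y = qim2 I" "z = qim3 I"
  have I: "I = Quat 0 x y z" "x * x + y * y + z * z = 1"
    using imag_unit_components[OF assms] by (simp_all add: x_y_z_def quat_eq_iff)
  have "z * z \<le> 1" using I(2) zero_le_square[of x] zero_le_square[of y] by linarith
  then have z: "- 1 \<le> z" "z \<le> 1"
    using abs_square_le_1[of z] by (auto simp: power2_eq_square abs_le_iff)
  define s where "s = sin (arccos z)"
  have s2: "s\<^sup>2 = x\<^sup>2 + y\<^sup>2"
    using I(2) unfolding s_def sin_squared_eq cos_arccos[OF z] by (simp add: power2_eq_square)
  obtain \<psi> where \<psi>: "0 \<le> \<psi>" "\<psi> \<le> 2 * pi" "x = s * cos \<psi>" "y = s * sin \<psi>"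
  proof (cases "s = 0")
    case True
    then have "x = 0" "y = 0" using s2 by (auto simp: sum_power2_eq_zero_iff)
    then show ?thesis using that[of 0] True by simp
  next
    case False
    have "(x / s)\<^sup>2 + (y / s)\<^sup>2 = (x\<^sup>2 + y\<^sup>2) / s\<^sup>2"
      by (simp add: power_divide add_divide_distrib)
    also have "\<dots> = 1"
      unfolding s2[symmetric] using False by simp
    finally obtain t where "0 \<le> t" "t < 2 * pi" "x / s = cos t" "y / s = sin t"
      using sincos_total_2pi by metis
    then show ?thesis using that[of t] False by (simp add: field_simps)
  qed
  have "sphere_point (arccos z, \<psi>) = I"
    using \<psi> z by (simp add: sphere_point_def I(1) s_def)
  moreover have "(arccos z, \<psi>) \<in> cbox (0, 0) (pi, 2 * pi)"
    using \<psi> z arccos_lbound[of z] arccos_ubound[of z] by (simp add: cbox_Pair_eq)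
  ultimately show ?thesis by blast
qed

text \<open>The area measure has full support on the sphere of imaginary units.\<close>

lemma sphere_area_continuous_nonneg:
  fixes G :: "quat \<Rightarrow> real"
  assumes AE: "AE I in sphere_area. 0 \<le> G I" and G: "continuous_on imag_units G" and I: "I \<in> imag_units"
  shows "0 \<le> G I"
proof -
  let ?B = "box (0, 0) (pi, 2 * pi) :: (real \<times> real) set"
  let ?g = "\<lambda>p. G (sphere_point p)"
  have "continuous_on UNIV sphere_point"
    unfolding sphere_point_def case_prod_unfold by (intro continuous_intros)
  then have cont: "continuous_on UNIV ?g"
    by (rule continuous_on_compose2[OF G]) (auto simp: sphere_point_imag)
  have "AE p in density lborel (\<lambda>(\<phi>, \<psi>). ennreal (sin \<phi>) * indicator ({0..pi} \<times> {0..<2 * pi}) (\<phi>, \<psi>)). 0 \<le> ?g p"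
    using AE unfolding sphere_area_def by (rule AE_distrD[rotated]) simp
  then have "AE p in lborel. 0 < (case p of (\<phi>, \<psi>) \<Rightarrow> ennreal (sin \<phi>) * indicator ({0..pi} \<times> {0..<2 * pi}) (\<phi>, \<psi>)) \<longrightarrow> 0 \<le> ?g p"
    by (subst (asm) AE_density) simp_all
  then have ae: "AE p in lborel. p \<in> ?B \<longrightarrow> 0 \<le> ?g p"
  proof eventually_elim
    case (elim p)
    show ?case
    proof
      assume p: "p \<in> ?B"
      obtain \<phi> \<psi> where [simp]: "p = (\<phi>, \<psi>)" by (cases p)
      have "0 < \<phi>" "\<phi> < pi" "0 < \<psi>" "\<psi> < 2 * pi"
        using p by (auto simp: box_def Basis_prod_def)
      then show "0 \<le> ?g p"
        using elim sin_gt_zero[of \<phi>] by (simp add: indicator_times)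
    qed
  qed
  have "0 \<le> ?g p" if "p \<in> ?B" for p
  proof (rule ccontr)
    assume "\<not> 0 \<le> ?g p"
    moreover have op: "open ({p. ?g p < 0} \<inter> ?B)"
      by (intro open_Int open_box open_Collect_less cont continuous_intros)
    ultimately have "\<not> negligible ({p. ?g p < 0} \<inter> ?B)"
      using that by (intro open_not_negligible) (auto simp: not_le)
    moreover have "AE p in lborel. p \<notin> {p. ?g p < 0} \<inter> ?B"
      using ae by eventually_elim auto
    then have "{p. ?g p < 0} \<inter> ?B \<in> null_sets lborel"
      using op by (simp add: AE_iff_null_sets borel_open)
    then have "negligible ({p. ?g p < 0} \<inter> ?B)"
      by (simp add: negligible_iff_null_sets null_sets_completionI)
    ultimately show False by simp
  qed
  then have "0 \<le> ?g p" if "p \<in> closure ?B" for p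
    by (intro continuous_ge_on_closure[OF continuous_on_subset[OF cont] that]) auto
  moreover have "closure ?B = cbox (0, 0) (pi, 2 * pi)"
    by (rule closure_box) (auto simp: box_def Basis_prod_def intro!: exI[of _ "pi / 2"])
  ultimately show ?thesis
    using sphere_point_surj[OF I] by metis
qed

lemma slice_emb_exhaust:
  obtains I w where "I \<in> imag_units" "0 \<le> Im w" "q = slice_emb I w"
proof (cases "q - of_real (qre q) = 0")
  case True
  have "Quat 0 1 0 0 \<in> imag_units" by (simp add: imag_units_iff norm_quat_def)
  moreover have "q = slice_emb (Quat 0 1 0 0) (of_real (qre q))"
    using True by (simp add: slice_emb_def)
  ultimately show ?thesis using that[of "Quat 0 1 0 0" "of_real (qre q)"] by simp
next
  case False
  let ?q = "q - of_real (qre q)"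
  have unit: "?q /\<^sub>R norm ?q \<in> imag_units"
    using False by (simp add: imag_units_iff)
  have decomp: "q = slice_emb (?q /\<^sub>R norm ?q) (Complex (qre q) (norm ?q))"
    using False by (simp add: slice_emb_def)
  show ?thesis by (rule that[OF unit _ decomp]) simp
qed

lemma identified_unit_slice_emb:
  assumes I: "I \<in> imag_units" and w: "0 < Im w" and J: "identified_unit (slice_emb I w) J"
  shows "J = I"
proof -
  have qre: "qre (slice_emb I w) = Re w"
    using imag_unit_components(1)[OF I] by (simp add: slice_emb_def)
  have I1: "norm I = 1" using I by (simp add: imag_units_iff)
  have "slice_emb I w \<notin> \<real>"
  proof
    assume "slice_emb I w \<in> \<real>"
    then obtain r where "slice_emb I w = of_real r" by (auto elim: Reals_cases)
    then have "Im w *\<^sub>R I = 0" using qre by (simp add: slice_emb_def)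
    then show False using w I1 by auto
  qed
  then have "J = (slice_emb I w - of_real (Re w)) /\<^sub>R norm (slice_emb I w - of_real (Re w))"
    using J unfolding identified_unit_def qre by simp
  also have "\<dots> = I"
    using w I1 by (simp add: slice_emb_def)
  finally show ?thesis .
qed

section \<open>The criterion\<close>

theorem proposition4p7:
  fixes f :: "quat \<Rightarrow> quat" and unit_of :: "quat \<Rightarrow> quat"
  assumes "f \<in> hardy2"
    and "\<And>\<omega>. \<omega> \<in> ball 0 1 \<Longrightarrow> identified_unit \<omega> (unit_of \<omega>)"
    and "\<And>\<omega>. \<omega> \<in> ball 0 1 \<Longrightarrow>
      ereal (1 / (2 * pi)) *
        ext_integral (restrict_space lborel {0..2 * pi})
          (\<lambda>\<theta>. elog (norm (radial_limit f (slice_moebius \<omega> (qcis (unit_of \<omega>) \<theta>)))))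
      = elog (norm (f \<omega>))"
  shows "outer f"
  unfolding outer_def
proof (intro conjI ballI impI)
  show "f \<in> hardy2" by fact
  fix h assume h: "h \<in> hardy2"
    and eq: "AE q in boundary_measure. norm (radial_limit f q) = norm (radial_limit h q)"
  have contf: "continuous_on (ball 0 1) f" and conth: "continuous_on (ball 0 1) h"
    using assms(1) h by (simp_all add: continuous_on_hardy2)
  have good: "norm (h (slice_emb I w)) \<le> norm (f (slice_emb I w))"
    if I: "I \<in> imag_units" and ae: "AE t in lborel. norm (radial_limit f (qcis I t)) = norm (radial_limit h (qcis I t))"
      and w: "cmod w < 1" "0 < Im w" for I w
  proof -
    let ?\<omega> = "slice_emb I w"
    have \<omega>: "?\<omega> \<in> ball 0 1" using w norm_slice_emb[OF I, of w] by simp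
    have unit: "unit_of ?\<omega> = I"
      by (rule identified_unit_slice_emb[OF I w(2) assms(2)[OF \<omega>]])
    have "AE t in lborel. norm (radial_limit f (slice_emb I (cis t))) = norm (radial_limit h (slice_emb I (cis t)))"
      using ae by (simp add: slice_emb_cis)
    from AE_moebius[OF w(1) this]
    have "AE t in restrict_space lborel {0..2 * pi}. elog (norm (radial_limit h (slice_emb I (disc_moebius w (cis t)))))
        \<le> elog (norm (radial_limit f (slice_emb I (disc_moebius w (cis t)))))"
      by (subst AE_restrict_space_iff) auto
    from ext_integral_mono_AE[OF this] have "ereal (1 / (2 * pi)) * ext_integral (restrict_space lborel {0..2 * pi})
          (\<lambda>t. elog (norm (radial_limit h (slice_emb I (disc_moebius w (cis t))))))
        \<le> ereal (1 / (2 * pi)) * ext_integral (restrict_space lborel {0..2 * pi})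
          (\<lambda>t. elog (norm (radial_limit f (slice_emb I (disc_moebius w (cis t))))))"
      by (intro ereal_mult_left_mono) simp_all
    also have "\<dots> = elog (norm (f ?\<omega>))"
      using assms(3)[OF \<omega>] unfolding unit slice_emb_cis[symmetric] slice_moebius_emb[OF I] .
    finally have "elog (norm (h ?\<omega>)) \<le> elog (norm (f ?\<omega>))"
      using hardy2_elog_le[OF I h w(1)] by (rule order.trans[rotated])
    then show ?thesis by (auto simp: elog_le_iff)
  qed
  have upper: "norm (h (slice_emb I w)) \<le> norm (f (slice_emb I w))"
    if I: "I \<in> imag_units" and w: "cmod w < 1" "0 < Im w" for I w
  proof -
    let ?G = "\<lambda>I. norm (f (slice_emb I w)) - norm (h (slice_emb I w))"
    have "0 \<le> ?G I"
    proof (rule sphere_area_continuous_nonneg[OF _ _ I])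
      show "AE I in sphere_area. 0 \<le> ?G I"
        using AE_boundary_slices[OF eq] AE_sphere_area
        by eventually_elim (use good w in auto)
      have *: "continuous_on imag_units (\<lambda>I. slice_emb I w)"
        unfolding slice_emb_def by (intro continuous_intros)
      show "continuous_on imag_units ?G"
        using w norm_slice_emb
        by (intro continuous_intros continuous_on_compose2[OF contf *] continuous_on_compose2[OF conth *]) auto
    qed
    then show ?thesis by simp
  qed
  fix q :: quat assume q: "q \<in> ball 0 1"
  \<comment> \<open>Real points are reached from the half plane \<open>Im w > 0\<close> of an arbitrary slice.\<close>
  obtain I w where Iw: "I \<in> imag_units" "0 \<le> Im w" "q = slice_emb I w"
    by (rule slice_emb_exhaust)
  have w: "cmod w < 1" using q Iw(3) norm_slice_emb[OF Iw(1), of w] by simp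
  show "norm (h q) \<le> norm (f q)"
  proof -
    let ?q = "\<lambda>y. slice_emb I (w + \<i> * of_real y)"
    have q_lim: "(?q \<longlongrightarrow> q) (at_right 0)"
      unfolding slice_emb_def Iw(3) by (auto intro!: tendsto_eq_intros)
    have lim: "((\<lambda>y. norm (k (?q y))) \<longlongrightarrow> norm (k q)) (at_right 0)" if "continuous_on (ball 0 1) k" for k :: "quat \<Rightarrow> quat"
    proof -
      have "isCont k q" using that q by (simp add: continuous_on_eq_continuous_at)
      then show ?thesis by (intro tendsto_norm isCont_tendsto_compose[OF _ q_lim])
    qed
    have "((\<lambda>y. cmod (w + \<i> * of_real y)) \<longlongrightarrow> cmod w) (at_right 0)"
      by (auto intro!: tendsto_eq_intros)
    then have "\<forall>\<^sub>F y in at_right 0. cmod (w + \<i> * of_real y) < 1"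
      using w by (rule order_tendstoD)
    then have "\<forall>\<^sub>F y in at_right 0. norm (h (?q y)) \<le> norm (f (?q y))"
      using eventually_at_right_less[of 0]
      by eventually_elim (use upper[OF Iw(1)] Iw(2) in auto)
    then show ?thesis
      by (intro tendsto_le[OF _ lim[OF contf] lim[OF conth]]) simp_all
  qed
qed

end
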